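(* Let $A=R/I$, $R=k[x_1,x_2,x_3]$, be an Artinian graded algebra of codimension $3$ with socle degree $s$. If $$\beta_{1,\,d+2}(\mathrm{Gin}(I))=\beta_{2,\,d+2}(\mathrm{Gin}(I))>0$$ for some $d<s$, then $A$ is not level.
   Context: $k$ is an infinite field of characteristic $0$. The socle degree $s$ is the largest degree with $A_s\ne0$. $A$ is level if its socle $\{a\in A:a\mathfrak m=0\}$ ($\mathfrak m$ the maximal homogeneous ideal) is concentrated in a single degree. $\beta_{i,j}(J)=\dim_k\mathrm{Tor}_i^R(J,k)_j$. $\mathrm{Gin}(I)$ is the generic initial ideal with respect to the degree reverse lexicographic order with $x_1>x_2>x_3$. *)

theory Defs
  imports Main HOL.Vector_Spaces "HOL-Library.Function_Algebras" "HOL-Library.Poly_Mapping" "HOL-Library.Product_Plus"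
begin

text \<open>A monomial x1^a x2^b x3^c is the exponent vector (a,b,c); a polynomial is a
finitely supported map from exponent vectors to coefficients.  Variable x_(i+1)
is indexed by i in {0,1,2}.\<close>

type_synonym mon3 = "nat \<times> nat \<times> nat"
type_synonym 'k poly3 = "mon3 \<Rightarrow>\<^sub>0 'k"

definition tdeg :: "mon3 \<Rightarrow> nat" where
  "tdeg m = fst m + fst (snd m) + snd (snd m)"

definition expo :: "mon3 \<Rightarrow> nat \<Rightarrow> nat" where
  "expo m i = (if i = 0 then fst m else if i = 1 then fst (snd m) else snd (snd m))"

definition Xv :: "nat \<Rightarrow> 'k::comm_ring_1 poly3" where
  "Xv i = Poly_Mapping.single (if i = 0 then (1,0,0) else if i = 1 then (0,1,0) else (0,0,1)) 1"

definition const3 :: "'k::comm_ring_1 \<Rightarrow> 'k poly3" where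
  "const3 c = Poly_Mapping.single 0 c"

text \<open>homogeneous of degree n (the zero polynomial is homogeneous of every degree)\<close>
definition homog :: "nat \<Rightarrow> 'k::comm_ring_1 poly3 \<Rightarrow> bool" where
  "homog n p \<longleftrightarrow> (\<forall>m\<in>Poly_Mapping.keys p. tdeg m = n)"

definition hcomp :: "nat \<Rightarrow> 'k::comm_ring_1 poly3 \<Rightarrow> 'k poly3" where
  "hcomp n p = Abs_poly_mapping (\<lambda>m. if tdeg m = n then Poly_Mapping.lookup p m else 0)"

definition is_ideal :: "'k::comm_ring_1 poly3 set \<Rightarrow> bool" where
  "is_ideal I \<longleftrightarrow> 0 \<in> I \<and> (\<forall>p\<in>I. \<forall>q\<in>I. p + q \<in> I) \<and> (\<forall>r. \<forall>p\<in>I. r * p \<in> I)"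

definition homogeneous_ideal :: "'k::comm_ring_1 poly3 set \<Rightarrow> bool" where
  "homogeneous_ideal I \<longleftrightarrow> is_ideal I \<and> (\<forall>p\<in>I. \<forall>n. hcomp n p \<in> I)"

definition A_nonzero_in :: "'k::comm_ring_1 poly3 set \<Rightarrow> nat \<Rightarrow> bool" where
  "A_nonzero_in I d \<longleftrightarrow> (\<exists>p. homog d p \<and> p \<notin> I)"

definition artinian :: "'k::comm_ring_1 poly3 set \<Rightarrow> bool" where
  "artinian I \<longleftrightarrow> (\<exists>N. \<forall>d\<ge>N. \<not> A_nonzero_in I d)"

definition socle_degree :: "'k::comm_ring_1 poly3 set \<Rightarrow> nat \<Rightarrow> bool" where
  "socle_degree I s \<longleftrightarrow> A_nonzero_in I s \<and> (\<forall>d>s. \<not> A_nonzero_in I d)"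

text \<open>The class of p in A lies in the socle iff p*x_i \<in> I for i=1,2,3 (the x_i generate
the maximal homogeneous ideal).  The class of p lies in A_t iff all homogeneous
components of p of degree \<noteq> t lie in I.  A is level iff the socle is contained in
a single A_t.\<close>
definition in_socle :: "'k::comm_ring_1 poly3 set \<Rightarrow> 'k poly3 \<Rightarrow> bool" where
  "in_socle I p \<longleftrightarrow> (\<forall>i<3. Xv i * p \<in> I)"

definition level :: "'k::comm_ring_1 poly3 set \<Rightarrow> bool" where
  "level I \<longleftrightarrow> (\<exists>t. \<forall>p. in_socle I p \<longrightarrow> (\<forall>d. d \<noteq> t \<longrightarrow> hcomp d p \<in> I))"

definition revlex_less :: "mon3 \<Rightarrow> mon3 \<Rightarrow> bool" where
  "revlex_less b a \<longleftrightarrow> tdeg b < tdeg a \<or>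
     (tdeg b = tdeg a \<and> (expo a 2 < expo b 2 \<or> (expo a 2 = expo b 2 \<and> expo a 1 < expo b 1)))"

definition lead_mon :: "'k::comm_ring_1 poly3 \<Rightarrow> mon3" where
  "lead_mon p = (THE m. m \<in> Poly_Mapping.keys p \<and> (\<forall>m'\<in>Poly_Mapping.keys p. m' \<noteq> m \<longrightarrow> revlex_less m' m))"

definition mon_dvd :: "mon3 \<Rightarrow> mon3 \<Rightarrow> bool" where
  "mon_dvd a b \<longleftrightarrow> (\<forall>i<3. expo a i \<le> expo b i)"

text \<open>in(J): the ideal generated by the leading monomials of the nonzero elements of J,
written out as the monomial ideal it is (a polynomial lies in a monomial ideal iff each
of its monomials is divisible by a generator).\<close>
definition initial_ideal :: "'k::comm_ring_1 poly3 set \<Rightarrow> 'k poly3 set" where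
  "initial_ideal J = {q. \<forall>m\<in>Poly_Mapping.keys q. \<exists>p\<in>J. p \<noteq> 0 \<and> mon_dvd (lead_mon p) m}"

definition subst3 :: "(nat \<Rightarrow> 'k::comm_ring_1 poly3) \<Rightarrow> 'k poly3 \<Rightarrow> 'k poly3" where
  "subst3 \<sigma> p = (\<Sum>m\<in>Poly_Mapping.keys p. const3 (Poly_Mapping.lookup p m) * \<sigma> 0 ^ expo m 0 * \<sigma> 1 ^ expo m 1 * \<sigma> 2 ^ expo m 2)"

definition act :: "(nat \<Rightarrow> nat \<Rightarrow> 'k::comm_ring_1) \<Rightarrow> 'k poly3 set \<Rightarrow> 'k poly3 set" where
  "act g I = subst3 (\<lambda>j. \<Sum>i<3. const3 (g i j) * Xv i) ` I"

definition det3 :: "(nat \<Rightarrow> nat \<Rightarrow> 'k::comm_ring_1) \<Rightarrow> 'k" where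
  "det3 g = g 0 0 * (g 1 1 * g 2 2 - g 1 2 * g 2 1)
          - g 0 1 * (g 1 0 * g 2 2 - g 1 2 * g 2 0)
          + g 0 2 * (g 1 0 * g 2 1 - g 1 1 * g 2 0)"

text \<open>Polynomials in the 9 matrix entries g_ij (i,j<3), used to describe Zariski-open sets.\<close>
type_synonym 'k poly9 = "((nat \<times> nat) \<Rightarrow>\<^sub>0 nat) \<Rightarrow>\<^sub>0 'k"

definition eval9 :: "'k::comm_ring_1 poly9 \<Rightarrow> (nat \<Rightarrow> nat \<Rightarrow> 'k) \<Rightarrow> 'k" where
  "eval9 f g = (\<Sum>m\<in>Poly_Mapping.keys f. Poly_Mapping.lookup f m * (\<Prod>v\<in>Poly_Mapping.keys m. g (fst v) (snd v) ^ Poly_Mapping.lookup m v))"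

definition matrix_poly :: "'k::comm_ring_1 poly9 \<Rightarrow> bool" where
  "matrix_poly f \<longleftrightarrow> (\<forall>m\<in>Poly_Mapping.keys f. Poly_Mapping.keys m \<subseteq> {..<3} \<times> {..<3})"

text \<open>Gin(I) = in(g I) for all g in a nonempty Zariski-open subset of GL_3(k)
(every nonempty Zariski-open set contains a nonempty basic open set f \<noteq> 0).\<close>
definition gin :: "'k::comm_ring_1 poly3 set \<Rightarrow> 'k poly3 set" where
  "gin I = (THE J. \<exists>f. matrix_poly f \<and> f \<noteq> 0 \<and>
              (\<forall>g. det3 g \<noteq> 0 \<and> eval9 f g \<noteq> 0 \<longrightarrow> initial_ideal (act g I) = J))"

text \<open>Tor_i^R(J,k) is computed as the homology of J \<otimes> K(x1,x2,x3), where K is the Koszul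
resolution of k.  An element of (J \<otimes> K_i)_j is a family c indexed by the i-subsets S of
{0,1,2} (basis e_S of K_i = R(-i)^(3 choose i)) with c S \<in> J_(j-i).\<close>
definition kchains :: "'k::comm_ring_1 poly3 set \<Rightarrow> nat \<Rightarrow> nat \<Rightarrow> (nat set \<Rightarrow> 'k poly3) set" where
  "kchains J i j = {c. \<forall>S. if S \<subseteq> {..<3} \<and> card S = i \<and> i \<le> j
                            then c S \<in> J \<and> homog (j - i) (c S) else c S = 0}"

text \<open>d(e_S) = \<Sum>_k (-1)^(k-1) x_(s_k) e_(S - s_k) for S = {s_1 < ... < s_i}\<close>
definition kdiff :: "(nat set \<Rightarrow> 'k::comm_ring_1 poly3) \<Rightarrow> nat set \<Rightarrow> 'k poly3" where
  "kdiff c T = (\<Sum>t\<in>{..<3} - T. (-1) ^ card {u\<in>T. u < t} * Xv t * c (insert t T))"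

definition kscale :: "'k::comm_ring_1 \<Rightarrow> (nat set \<Rightarrow> 'k poly3) \<Rightarrow> nat set \<Rightarrow> 'k poly3" where
  "kscale a c = (\<lambda>S. const3 a * c S)"

text \<open>beta_{i,j}(J) = dim_k Tor_i^R(J,k)_j = dim (ker d_i)_j - dim (im d_(i+1))_j\<close>
definition betti :: "'k::field poly3 set \<Rightarrow> nat \<Rightarrow> nat \<Rightarrow> nat" where
  "betti J i j = Vector_Spaces.vector_space.dim kscale (kchains J i j \<inter> {c. kdiff c = 0})
               - Vector_Spaces.vector_space.dim kscale (kdiff ` kchains J (Suc i) j)"

end

theory Submission
  imports Defs "HOL-Computational_Algebra.Polynomial"
begin

text \<open>Choose coordinates in which in(I) = Gin(I) and suppose that A is level. In reverse lexicographic
  coordinates the kernel K of multiplication by the last variable on A has a basis indexed by the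
  monomials u outside Gin(I) with x_3 u inside it, so Borel-fixedness (via Eliahou--Kervaire
  syzygies) turns the hypothesis on Betti numbers into dim K_(d-1) >= 2 dim K_d and K_(d-1) nonzero.
  As A has no socle in degree d-1, the map K_(d-1) \<rightarrow> K_d x K_d, v \<mapsto> (x_1 v, x_2 v), is injective,
  hence bijective with K_d nonzero. Any w in K_d is then w = x_1 v = x_2 v' with x_2 v = x_1 v' = 0,
  so that x_1 w = x_2 w = x_3 w = 0, which is a socle element in degree d < s.\<close>

section \<open>Polynomials in three variables\<close>

text \<open>The drop in dimension comes from two one-sided estimates for J = Gin(I): beta_(2,d+2)(J)
  is at most the number of basis monomials of K_(d-1), and beta_(1,d+2)(J) is at least twice the
  number of those of K_d. Equality of the Betti numbers chains the estimates together, so no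
  resolution of J is built. The main obstacle is that \<open>gin\<close> is a definite description:
  one ideal has to be in(g I) on a nonempty open set, and no other ideal may be. Existence uses an
  echelon basis whose coefficients are polynomials in the entries of g, so that its pivots do not
  vary with g; A being Artinian, finitely many degrees suffice. Uniqueness holds because two
  nonempty open sets meet over an infinite field. The bound d < s enters twice: a level A has its
  whole socle in degree s, hence none in degree d-1 (injectivity) and none in degree d (the
  contradiction).\<close>

abbreviation (input) lookup where "lookup \<equiv> Poly_Mapping.lookup"

definition var_exp :: "nat \<Rightarrow> mon3" where
  "var_exp i = (if i = 0 then (1,0,0) else if i = 1 then (0,1,0) else (0,0,1))"

lemma Xv_single: "Xv i = Poly_Mapping.single (var_exp i) 1"
  by (simp add: Xv_def var_exp_def)

lemma lookup_single_mult:
  fixes p :: "'a::cancel_comm_monoid_add \<Rightarrow>\<^sub>0 'k::comm_ring_1"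
  shows "lookup (Poly_Mapping.single a c * p) (a + m) = c * lookup p m"
proof -
  have "lookup (Poly_Mapping.single a c * p) (a + m)
      = (\<Sum>l. (c when a = l) * (\<Sum>q. lookup p q when a + m = l + q))"
    by (simp add: lookup_mult lookup_single)
  also have "\<dots> = (\<Sum>l. (c * (\<Sum>q. lookup p q when a + m = l + q)) when a = l)"
    by (simp add: when_mult)
  also have "\<dots> = c * (\<Sum>q. lookup p q when m = q)"
    by simp
  finally show ?thesis by simp
qed

lemma lookup_single_mult_eq_0:
  fixes p :: "'a::cancel_comm_monoid_add \<Rightarrow>\<^sub>0 'k::comm_ring_1"
  assumes "\<And>n. m \<noteq> a + n"
  shows "lookup (Poly_Mapping.single a c * p) m = 0"
proof -
  have "lookup (Poly_Mapping.single a c * p) m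
      = (\<Sum>l. (c * (\<Sum>q. lookup p q when m = l + q)) when a = l)"
    by (simp add: lookup_mult lookup_single when_mult)
  also have "\<dots> = c * (\<Sum>q. lookup p q when m = a + q)"
    by simp
  finally show ?thesis using assms by simp
qed

lemma lookup_const3_mult [simp]: "lookup (const3 c * p) m = c * lookup p m"
  using lookup_single_mult[of 0 c p m] by (simp add: const3_def)

lemma lookup_Xv_mult: "lookup (Xv i * p) (var_exp i + m) = lookup p m"
  by (simp add: Xv_single lookup_single_mult)

lemma lookup_Xv_mult_eq_0: "(\<And>n. m \<noteq> var_exp i + n) \<Longrightarrow> lookup (Xv i * p) m = 0"
  by (simp add: Xv_single lookup_single_mult_eq_0)

lemma const3_mult_single: "const3 c * Poly_Mapping.single m d = Poly_Mapping.single m (c * d)"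
  by (simp add: const3_def mult_single)

lemma Xv_mult_single:
  "Xv i * Poly_Mapping.single m c = Poly_Mapping.single (var_exp i + m) c"
  by (simp add: Xv_single mult_single)

lemma const3_0 [simp]: "const3 0 = 0"
  and const3_1 [simp]: "const3 1 = 1"
  and const3_add: "const3 (a + b) = const3 a + const3 b"
  and const3_mult: "const3 (a * b) = const3 a * const3 b"
  and const3_uminus: "const3 (- a) = - const3 a"
  by (simp_all add: const3_def single_add mult_single single_uminus)

lemma const3_power: "const3 (a ^ n) = const3 a ^ n"
  by (induction n) (simp_all add: const3_mult)

lemma nonzero_lookup: "p \<noteq> 0 \<Longrightarrow> \<exists>m. lookup p m \<noteq> 0"
  using poly_mapping_eqI[of p 0] by auto

lemma sum_monomials:
  fixes p :: "'a \<Rightarrow>\<^sub>0 'b::comm_monoid_add"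
  assumes "finite A" "Poly_Mapping.keys p \<subseteq> A"
  shows "p = (\<Sum>m\<in>A. Poly_Mapping.single m (lookup p m))"
proof (rule poly_mapping_eqI)
  fix k
  have "lookup (\<Sum>m\<in>A. Poly_Mapping.single m (lookup p m)) k
      = (\<Sum>m\<in>A. if k = m then lookup p m else 0)"
    by (auto simp: lookup_sum lookup_single when_def intro!: sum.cong)
  also have "\<dots> = lookup p k"
    using assms by (auto simp: in_keys_iff)
  finally show "lookup p k = lookup (\<Sum>m\<in>A. Poly_Mapping.single m (lookup p m)) k" by simp
qed

lemma poly_mapping_monomial_induct [case_names zero single add]:
  fixes p :: "'a \<Rightarrow>\<^sub>0 'b::comm_monoid_add"
  assumes "P 0" "\<And>m c. P (Poly_Mapping.single m c)" "\<And>p q. P p \<Longrightarrow> P q \<Longrightarrow> P (p + q)"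
  shows "P p"
proof -
  have "P (\<Sum>m\<in>A. Poly_Mapping.single m (lookup p m))" if "finite A" for A
    using that by induction (auto intro: assms)
  from this[of "Poly_Mapping.keys p"] show ?thesis
    using sum_monomials[of "Poly_Mapping.keys p" p] by simp
qed

text \<open>Common form of \<open>subst3\<close> and \<open>eval9\<close>. When \<open>h\<close> is
  additive and multiplicative and \<open>\<phi>\<close> is multiplicative on monomials, this is the
  evaluation homomorphism, so both get their ring laws from one proof.\<close>

definition monomial_ext :: "('c::zero \<Rightarrow> 'b::comm_ring_1) \<Rightarrow> ('m \<Rightarrow> 'b) \<Rightarrow> ('m \<Rightarrow>\<^sub>0 'c) \<Rightarrow> 'b" where
  "monomial_ext h \<phi> f = (\<Sum>m\<in>Poly_Mapping.keys f. h (lookup f m) * \<phi> m)"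

lemma monomial_ext_superset:
  assumes "finite A" "Poly_Mapping.keys f \<subseteq> A" "h 0 = 0"
  shows "monomial_ext h \<phi> f = (\<Sum>m\<in>A. h (lookup f m) * \<phi> m)"
  unfolding monomial_ext_def
  by (rule sum.mono_neutral_left) (use assms in \<open>auto simp: in_keys_iff\<close>)

lemma monomial_ext_add:
  fixes h :: "'c::comm_ring_1 \<Rightarrow> 'b::comm_ring_1"
  assumes "h 0 = 0" "\<And>a b. h (a + b) = h a + h b"
  shows "monomial_ext h \<phi> (f + g) = monomial_ext h \<phi> f + monomial_ext h \<phi> g"
proof -
  let ?A = "Poly_Mapping.keys f \<union> Poly_Mapping.keys g"
  have "Poly_Mapping.keys (f + g) \<subseteq> ?A" by (rule keys_add)
  then show ?thesis
    using monomial_ext_superset[of ?A f h \<phi>] monomial_ext_superset[of ?A g h \<phi>]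
      monomial_ext_superset[of ?A "f + g" h \<phi>] assms
    by (simp add: lookup_add distrib_right sum.distrib)
qed

lemma monomial_ext_0 [simp]: "monomial_ext h \<phi> 0 = 0"
  by (simp add: monomial_ext_def)

lemma monomial_ext_single: "h 0 = 0 \<Longrightarrow> monomial_ext h \<phi> (Poly_Mapping.single m c) = h c * \<phi> m"
  by (simp add: monomial_ext_def)

lemma monomial_ext_mult:
  fixes h :: "'c::comm_ring_1 \<Rightarrow> 'b::comm_ring_1" and \<phi> :: "'m::cancel_comm_monoid_add \<Rightarrow> 'b"
  assumes h: "h 0 = 0" "\<And>a b. h (a + b) = h a + h b" "\<And>a b. h (a * b) = h a * h b"
    and \<phi>: "\<And>m n. \<phi> (m + n) = \<phi> m * \<phi> n"
  shows "monomial_ext h \<phi> (f * g) = monomial_ext h \<phi> f * monomial_ext h \<phi> g"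
proof (induction f rule: poly_mapping_monomial_induct)
  case (single m c)
  show ?case
  proof (induction g rule: poly_mapping_monomial_induct)
    case (single n d)
    then show ?case by (simp add: mult_single monomial_ext_single h \<phi> algebra_simps)
  qed (simp_all add: distrib_left monomial_ext_add h)
qed (simp_all add: distrib_right monomial_ext_add h)

lemma subst3_eq: "subst3 \<sigma> = monomial_ext const3 (\<lambda>m. \<sigma> 0 ^ expo m 0 * \<sigma> 1 ^ expo m 1 * \<sigma> 2 ^ expo m 2)"
  by (rule ext) (simp add: subst3_def monomial_ext_def mult.assoc)

lemma expo_simps [simp]: "expo (a, b, c) 0 = a" "expo (a, b, c) (Suc 0) = b" "expo (a, b, c) 2 = c"
  by (simp_all add: expo_def)

lemma expo_add: "expo (m + n) i = expo m i + expo n i"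
  by (simp add: expo_def)

lemma expo_0 [simp]: "expo 0 i = 0"
  by (simp add: expo_def)

lemma expo_var_exp: "i < 3 \<Longrightarrow> j < 3 \<Longrightarrow> expo (var_exp i) j = (if i = j then 1 else 0)"
  by (auto simp: expo_def var_exp_def)

lemma subst3_0 [simp]: "subst3 \<sigma> 0 = 0"
  by (simp add: subst3_eq)

lemma subst3_add: "subst3 \<sigma> (p + q) = subst3 \<sigma> p + subst3 \<sigma> q"
  unfolding subst3_eq by (rule monomial_ext_add) (simp_all add: const3_add)

lemma subst3_mult: "subst3 \<sigma> (p * q) = subst3 \<sigma> p * subst3 \<sigma> q"
  unfolding subst3_eq
  by (rule monomial_ext_mult) (simp_all add: const3_add const3_mult expo_add power_add ac_simps)

lemma subst3_single:
  "subst3 \<sigma> (Poly_Mapping.single m c)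
    = const3 c * (\<sigma> 0 ^ expo m 0 * \<sigma> 1 ^ expo m 1 * \<sigma> 2 ^ expo m 2)"
  by (simp add: subst3_eq monomial_ext_single)

lemma subst3_const3 [simp]: "subst3 \<sigma> (const3 c) = const3 c"
  unfolding const3_def[of c] subst3_single by (simp add: const3_def)

lemma subst3_1 [simp]: "subst3 \<sigma> 1 = 1"
  using subst3_const3[of \<sigma> 1] by simp

lemma subst3_Xv: "i < 3 \<Longrightarrow> subst3 \<sigma> (Xv i) = \<sigma> i"
proof -
  assume "i < 3"
  then have "i = 0 \<or> i = 1 \<or> i = 2" by auto
  then show ?thesis
    by (auto simp: Xv_single subst3_single var_exp_def)
qed

lemma subst3_power: "subst3 \<sigma> (p ^ n) = subst3 \<sigma> p ^ n"
  by (induction n) (simp_all add: subst3_mult)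

lemma subst3_sum: "subst3 \<sigma> (\<Sum>x\<in>A. f x) = (\<Sum>x\<in>A. subst3 \<sigma> (f x))"
  by (induction A rule: infinite_finite_induct) (simp_all add: subst3_add)

lemma subst3_cong: "(\<And>i. i < 3 \<Longrightarrow> \<sigma> i = \<tau> i) \<Longrightarrow> subst3 \<sigma> p = subst3 \<tau> p"
  by (simp add: subst3_def)

lemma subst3_subst3: "subst3 \<sigma> (subst3 \<tau> p) = subst3 (\<lambda>i. subst3 \<sigma> (\<tau> i)) p"
  by (induction p rule: poly_mapping_monomial_induct)
    (simp_all add: subst3_add subst3_single subst3_mult subst3_power)

lemma single_eq_powers:
  "Poly_Mapping.single m c = const3 c * (Xv 0 ^ expo m 0 * Xv 1 ^ expo m 1 * Xv 2 ^ expo m 2)"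
proof -
  have pw: "Xv i ^ n = (Poly_Mapping.single (if i = 0 then (n,0,0) else if i = 1 then (0,n,0) else (0,0,n)) 1
      :: 'a poly3)" for i n
    by (induction n) (auto simp: Xv_def mult_single zero_prod_def simp flip: single_one)
  show ?thesis
    by (cases m) (simp add: pw mult_single const3_def)
qed

lemma subst3_id: "(\<And>i. i < 3 \<Longrightarrow> \<sigma> i = Xv i) \<Longrightarrow> subst3 \<sigma> p = p"
proof -
  assume a: "\<And>i. i < 3 \<Longrightarrow> \<sigma> i = Xv i"
  show ?thesis
  proof (induction p rule: poly_mapping_monomial_induct)
    case (single m c)
    show ?case
      unfolding subst3_single by (simp add: a single_eq_powers)
  qed (simp_all add: subst3_add)
qed

subsection \<open>Homogeneous components\<close>

lemma tdeg_add [simp]: "tdeg (m + n) = tdeg m + tdeg n"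
  by (simp add: tdeg_def)

lemma tdeg_var_exp [simp]: "tdeg (var_exp i) = 1"
  by (simp add: tdeg_def var_exp_def)

lemma finite_tdeg: "finite {m. tdeg m = n}"
proof (rule finite_subset)
  show "{m. tdeg m = n} \<subseteq> {..n} \<times> {..n} \<times> {..n}"
    by (auto simp: tdeg_def)
qed auto

lemma lookup_hcomp: "lookup (hcomp n p) m = (if tdeg m = n then lookup p m else 0)"
proof -
  have "finite {m. (if tdeg m = n then lookup p m else 0) \<noteq> 0}"
    by (rule finite_subset[OF _ finite_keys[of p]]) (auto simp: in_keys_iff)
  then show ?thesis by (simp add: hcomp_def)
qed

lemma homog_0 [simp]: "homog n 0"
  by (simp add: homog_def)

lemma homog_lookup: "homog n p \<longleftrightarrow> (\<forall>m. lookup p m \<noteq> 0 \<longrightarrow> tdeg m = n)"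
  by (simp only: homog_def in_keys_iff Ball_def)

lemma homog_add: "homog n p \<Longrightarrow> homog n q \<Longrightarrow> homog n (p + q)"
  unfolding homog_lookup lookup_add by (metis add_0)

lemma homog_uminus: "homog n p \<Longrightarrow> homog n (- p)"
  by (simp add: homog_lookup)

lemma homog_diff: "homog n p \<Longrightarrow> homog n q \<Longrightarrow> homog n (p - q)"
  using homog_add[of n p "- q"] homog_uminus[of n q] by simp

lemma homog_sum: "(\<And>x. x \<in> A \<Longrightarrow> homog n (f x)) \<Longrightarrow> homog n (\<Sum>x\<in>A. f x)"
  by (induction A rule: infinite_finite_induct) (simp_all add: homog_add)

lemma homog_mult: "homog m p \<Longrightarrow> homog n q \<Longrightarrow> homog (m + n) (p * q)"
  unfolding homog_def
proof
  fix c assume "\<forall>m'\<in>Poly_Mapping.keys p. tdeg m' = m" "\<forall>m\<in>Poly_Mapping.keys q. tdeg m = n"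
    "c \<in> Poly_Mapping.keys (p * q)"
  moreover from this obtain a b where "c = a + b" "a \<in> Poly_Mapping.keys p" "b \<in> Poly_Mapping.keys q"
    using keys_mult[of p q] by blast
  ultimately show "tdeg c = m + n" by simp
qed

lemma homog_const3: "homog 0 (const3 c)"
  by (simp add: homog_def const3_def tdeg_def)

lemma homog_const3_mult: "homog n p \<Longrightarrow> homog n (const3 c * p)"
  using homog_mult[OF homog_const3, of n p] by simp

lemma homog_single: "homog (tdeg m) (Poly_Mapping.single m c)"
  by (simp add: homog_def)

lemma homog_Xv: "homog 1 (Xv i)"
  using homog_single[of "var_exp i" 1] unfolding Xv_single tdeg_var_exp .

lemma homog_Xv_mult: "homog n p \<Longrightarrow> homog (Suc n) (Xv i * p)"
  using homog_mult[OF homog_Xv, of n p] by simp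

lemma homog_power: "homog m p \<Longrightarrow> homog (m * n) (p ^ n)"
proof (induction n)
  case 0
  then show ?case using homog_const3[of 1] by simp
next
  case (Suc n)
  then show ?case using homog_mult[of m p "m * n" "p ^ n"] by simp
qed

lemma homog_hcomp [simp]: "homog n (hcomp n p)"
  by (simp add: homog_lookup lookup_hcomp)

lemma hcomp_homog: "homog n p \<Longrightarrow> hcomp d p = (if d = n then p else 0)"
  by (rule poly_mapping_eqI) (auto simp: homog_lookup lookup_hcomp)

lemma hcomp_add: "hcomp n (p + q) = hcomp n p + hcomp n q"
  by (rule poly_mapping_eqI) (simp add: lookup_hcomp lookup_add)

lemma hcomp_0 [simp]: "hcomp n 0 = 0"
  by (rule poly_mapping_eqI) (simp add: lookup_hcomp)

subsection \<open>Linear changes of coordinates\<close>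

text \<open>Column j of g holds the image of variable j. With this convention composing
  substitutions is the matrix product in the same order.\<close>

definition linear_form :: "(nat \<Rightarrow> nat \<Rightarrow> 'k::comm_ring_1) \<Rightarrow> nat \<Rightarrow> 'k poly3" where
  "linear_form g j = (\<Sum>i<3. const3 (g i j) * Xv i)"

definition mat_mult3 :: "(nat \<Rightarrow> nat \<Rightarrow> 'k::comm_ring_1) \<Rightarrow> (nat \<Rightarrow> nat \<Rightarrow> 'k) \<Rightarrow> nat \<Rightarrow> nat \<Rightarrow> 'k" where
  "mat_mult3 g h i j = (\<Sum>k<3. g i k * h k j)"

lemma act_eq: "act g I = subst3 (linear_form g) ` I"
proof -
  have "linear_form g = (\<lambda>j. \<Sum>i<3. const3 (g i j) * Xv i)"
    by (rule ext) (rule linear_form_def)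
  then show ?thesis by (simp only: act_def)
qed

lemma sum_less_3: "(\<Sum>i<3. f i) = f 0 + f 1 + f (2::nat)"
  by (simp add: numeral_3_eq_3 numeral_2_eq_2)

lemma homog_linear_form: "homog 1 (linear_form g j)"
  unfolding linear_form_def by (intro homog_sum homog_const3_mult homog_Xv)

lemma subst3_linear_form:
  "subst3 (linear_form g) (linear_form h j) = linear_form (mat_mult3 g h) j"
proof -
  have "subst3 (linear_form g) (linear_form h j) = (\<Sum>k<3. const3 (h k j) * linear_form g k)"
    unfolding linear_form_def[of h] by (simp add: subst3_sum subst3_mult subst3_Xv)
  also have "\<dots> = linear_form (mat_mult3 g h) j"
    unfolding linear_form_def mat_mult3_def sum_less_3
    by (simp add: const3_add const3_mult algebra_simps)
  finally show ?thesis .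
qed

lemma subst3_mat_mult3:
  "subst3 (linear_form g) (subst3 (linear_form h) p) = subst3 (linear_form (mat_mult3 g h)) p"
  by (simp add: subst3_subst3 subst3_linear_form)

lemma homog_subst3:
  assumes "homog n p"
  shows "homog n (subst3 (linear_form g) p)"
proof -
  have m: "homog (tdeg m) (const3 c * (linear_form g 0 ^ expo m 0 * linear_form g 1 ^ expo m 1
      * linear_form g 2 ^ expo m 2))" for m c
  proof -
    have "homog (1 * expo m 0 + 1 * expo m 1 + 1 * expo m 2)
      (linear_form g 0 ^ expo m 0 * linear_form g 1 ^ expo m 1 * linear_form g 2 ^ expo m 2)"
      by (intro homog_mult homog_power homog_linear_form)
    then show ?thesis by (intro homog_const3_mult) (simp add: tdeg_def expo_def)
  qed
  show ?thesis
    unfolding subst3_eq monomial_ext_def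
    by (rule homog_sum) (metis assms homog_def m)
qed

lemma hcomp_subst3: "hcomp n (subst3 (linear_form g) p) = subst3 (linear_form g) (hcomp n p)"
proof (induction p rule: poly_mapping_monomial_induct)
  case (single m c)
  then show ?case
    by (simp add: hcomp_homog[OF homog_single] hcomp_homog[OF homog_subst3[OF homog_single]])
qed (simp_all add: hcomp_add subst3_add)

lemma mat3_inverse:
  fixes g :: "nat \<Rightarrow> nat \<Rightarrow> 'k::field"
  assumes "det3 g \<noteq> 0"
  obtains h where "\<And>i j. i < 3 \<Longrightarrow> j < 3 \<Longrightarrow> mat_mult3 g h i j = (if i = j then 1 else 0)"
    "\<And>i j. i < 3 \<Longrightarrow> j < 3 \<Longrightarrow> mat_mult3 h g i j = (if i = j then 1 else 0)"
proof
  \<comment> \<open>The adjugate (transposed cofactor matrix) of g.\<close>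
  define a where "a = (\<lambda>(i::nat) (j::nat).
    if i = 0 then (if j = 0 then g 1 1 * g 2 2 - g 1 2 * g 2 1
                   else if j = 1 then g 0 2 * g 2 1 - g 0 1 * g 2 2
                   else g 0 1 * g 1 2 - g 0 2 * g 1 1)
    else if i = 1 then (if j = 0 then g 1 2 * g 2 0 - g 1 0 * g 2 2
                   else if j = 1 then g 0 0 * g 2 2 - g 0 2 * g 2 0
                   else g 0 2 * g 1 0 - g 0 0 * g 1 2)
    else (if j = 0 then g 1 0 * g 2 1 - g 1 1 * g 2 0
                   else if j = 1 then g 0 1 * g 2 0 - g 0 0 * g 2 1
                   else g 0 0 * g 1 1 - g 0 1 * g 1 0))"
  define h where "h = (\<lambda>i j. a i j / det3 g)"
  fix i j :: nat assume "i < 3" "j < 3"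
  then have ij: "i = 0 \<or> i = 1 \<or> i = 2" "j = 0 \<or> j = 1 \<or> j = 2" by auto
  have "mat_mult3 g a i j = (if i = j then det3 g else 0)"
    using ij by (elim disjE) (simp_all add: mat_mult3_def sum_less_3 a_def det3_def algebra_simps)
  moreover have "mat_mult3 g h i j = mat_mult3 g a i j / det3 g"
    by (simp add: mat_mult3_def h_def sum_divide_distrib)
  ultimately show "mat_mult3 g h i j = (if i = j then 1 else 0)"
    using assms by simp
  have "mat_mult3 a g i j = (if i = j then det3 g else 0)"
    using ij by (elim disjE) (simp_all add: mat_mult3_def sum_less_3 a_def det3_def algebra_simps)
  moreover have "mat_mult3 h g i j = mat_mult3 a g i j / det3 g"
    by (simp add: mat_mult3_def h_def sum_divide_distrib)
  ultimately show "mat_mult3 h g i j = (if i = j then 1 else 0)"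
    using assms by simp
qed

lemma subst3_inverse:
  fixes g :: "nat \<Rightarrow> nat \<Rightarrow> 'k::field"
  assumes "det3 g \<noteq> 0"
  obtains h where "\<And>p. subst3 (linear_form g) (subst3 (linear_form h) p) = p"
    "\<And>p. subst3 (linear_form h) (subst3 (linear_form g) p) = p"
proof -
  have id: "subst3 (linear_form u) p = p"
    if u: "\<And>i j. i < 3 \<Longrightarrow> j < 3 \<Longrightarrow> u i j = (if i = j then 1 else 0)" for u :: "nat \<Rightarrow> nat \<Rightarrow> 'k" and p
  proof (rule subst3_id)
    fix j :: nat assume "j < 3"
    then have "j = 0 \<or> j = 1 \<or> j = 2" by auto
    then show "linear_form u j = Xv j"
      by (auto simp: linear_form_def sum_less_3 u)
  qed
  obtain h where "\<And>i j. i < 3 \<Longrightarrow> j < 3 \<Longrightarrow> mat_mult3 g h i j = (if i = j then 1 else 0)"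
    "\<And>i j. i < 3 \<Longrightarrow> j < 3 \<Longrightarrow> mat_mult3 h g i j = (if i = j then 1 else 0)"
    using mat3_inverse[OF assms] by blast
  then show ?thesis
    using that[of h] id by (simp add: subst3_mat_mult3)
qed

subsection \<open>Ideals\<close>

lemma is_ideal_0: "is_ideal I \<Longrightarrow> 0 \<in> I"
  and is_ideal_add: "is_ideal I \<Longrightarrow> p \<in> I \<Longrightarrow> q \<in> I \<Longrightarrow> p + q \<in> I"
  and is_ideal_mult: "is_ideal I \<Longrightarrow> p \<in> I \<Longrightarrow> r * p \<in> I"
  by (simp_all add: is_ideal_def)

lemma is_ideal_uminus: "is_ideal I \<Longrightarrow> p \<in> I \<Longrightarrow> - p \<in> I"
  using is_ideal_mult[of I p "- 1"] by simp

lemma is_ideal_diff: "is_ideal I \<Longrightarrow> p \<in> I \<Longrightarrow> q \<in> I \<Longrightarrow> p - q \<in> I"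
  using is_ideal_add[of I p "- q"] is_ideal_uminus[of I q] by simp

lemma is_ideal_sum: "is_ideal I \<Longrightarrow> (\<And>x. x \<in> A \<Longrightarrow> f x \<in> I) \<Longrightarrow> (\<Sum>x\<in>A. f x) \<in> I"
  by (induction A rule: infinite_finite_induct) (simp_all add: is_ideal_add is_ideal_0)

lemma homogeneous_ideal_hcomp: "homogeneous_ideal I \<Longrightarrow> p \<in> I \<Longrightarrow> hcomp n p \<in> I"
  and homogeneous_ideal_is_ideal: "homogeneous_ideal I \<Longrightarrow> is_ideal I"
  by (simp_all add: homogeneous_ideal_def)

text \<open>\<open>act g I\<close> is defined as a mere image. It absorbs multiplication by r
  because r is itself the image of its pullback under the inverse substitution; this is where the
  determinant matters.\<close>

lemma homogeneous_ideal_act: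
  fixes I :: "'k::field poly3 set"
  assumes I: "homogeneous_ideal I" and g: "det3 g \<noteq> 0"
  shows "homogeneous_ideal (act g I)"
proof -
  note I' = homogeneous_ideal_is_ideal[OF I]
  obtain h where gh: "\<And>p. subst3 (linear_form g) (subst3 (linear_form h) p) = p"
    using subst3_inverse[OF g] by metis
  have "r * subst3 (linear_form g) p \<in> act g I" if "p \<in> I" for r p
  proof -
    have "r * subst3 (linear_form g) p = subst3 (linear_form g) (subst3 (linear_form h) r * p)"
      by (simp add: subst3_mult gh)
    then show ?thesis using is_ideal_mult[OF I' that] by (auto simp: act_eq)
  qed
  moreover have "0 \<in> act g I"
    using is_ideal_0[OF I'] subst3_0 by (force simp: act_eq)
  ultimately have "is_ideal (act g I)"
    unfolding is_ideal_def
    by (auto simp: act_eq simp flip: subst3_add intro: is_ideal_add[OF I'])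
  moreover have "hcomp n p \<in> act g I" if "p \<in> act g I" for n p
    using that homogeneous_ideal_hcomp[OF I] by (auto simp: act_eq hcomp_subst3)
  ultimately show ?thesis by (simp add: homogeneous_ideal_def)
qed

lemma act_inverse:
  assumes "\<And>p. subst3 (linear_form h) (subst3 (linear_form g) p) = p"
  shows "subst3 (linear_form g) p \<in> act g I \<longleftrightarrow> p \<in> I"
  unfolding act_eq using assms by (metis image_iff)

text \<open>The socle is what all linear forms annihilate. An invertible linear substitution maps
  linear forms to linear forms and preserves degrees, so it carries socle to socle degree by
  degree.\<close>

lemma level_act:
  fixes I :: "'k::field poly3 set"
  assumes I: "homogeneous_ideal I" and g: "det3 g \<noteq> 0" and lev: "level I"
  shows "level (act g I)"
proof -
  let ?J = "act g I"
  note J' = homogeneous_ideal_is_ideal[OF homogeneous_ideal_act[OF I g]]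
  obtain h where gh: "\<And>p. subst3 (linear_form g) (subst3 (linear_form h) p) = p"
    and hg: "\<And>p. subst3 (linear_form h) (subst3 (linear_form g) p) = p"
    using subst3_inverse[OF g] by metis
  note mem = act_inverse[OF hg, of _ I]
  obtain t where t: "\<And>p d. in_socle I p \<Longrightarrow> d \<noteq> t \<Longrightarrow> hcomp d p \<in> I"
    using lev unfolding level_def by blast
  have "hcomp d p \<in> ?J" if p: "in_socle ?J p" and d: "d \<noteq> t" for p d
  proof -
    have "Xv i * subst3 (linear_form h) p \<in> I" if "i < 3" for i
    proof -
      have "subst3 (linear_form g) (Xv i * subst3 (linear_form h) p) = linear_form g i * p"
        by (simp add: subst3_mult subst3_Xv that gh)
      also have "\<dots> = (\<Sum>j<3. const3 (g j i) * (Xv j * p))"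
        by (simp add: linear_form_def sum_distrib_right mult.assoc)
      also have "\<dots> \<in> ?J"
        by (intro is_ideal_sum[OF J'], rule is_ideal_mult[OF J']) (use p in \<open>auto simp: in_socle_def\<close>)
      finally show ?thesis by (simp add: mem)
    qed
    then have "hcomp d (subst3 (linear_form h) p) \<in> I"
      by (intro t d) (simp add: in_socle_def)
    then have "subst3 (linear_form g) (hcomp d (subst3 (linear_form h) p)) \<in> ?J"
      by (simp add: mem)
    then show ?thesis by (simp add: gh flip: hcomp_subst3)
  qed
  then show ?thesis unfolding level_def by blast
qed

lemma A_nonzero_in_act:
  fixes I :: "'k::field poly3 set"
  assumes g: "det3 g \<noteq> 0"
  shows "A_nonzero_in (act g I) d \<longleftrightarrow> A_nonzero_in I d"
proof -
  obtain h where gh: "\<And>p. subst3 (linear_form g) (subst3 (linear_form h) p) = p"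
    and hg: "\<And>p. subst3 (linear_form h) (subst3 (linear_form g) p) = p"
    using subst3_inverse[OF g] by metis
  note mem = act_inverse[OF hg, of _ I]
  show ?thesis
    unfolding A_nonzero_in_def using gh mem homog_subst3 by metis
qed

subsection \<open>Division by a variable\<close>

lemma var_exp_dvd_iff: "i < 3 \<Longrightarrow> (\<exists>n. m = var_exp i + n) \<longleftrightarrow> expo m i \<noteq> 0"
proof
  assume "i < 3" "expo m i \<noteq> 0"
  moreover obtain a b c where m: "m = (a, b, c)" by (cases m)
  ultimately have "i = 0 \<and> a \<noteq> 0 \<or> i = 1 \<and> b \<noteq> 0 \<or> i = 2 \<and> c \<noteq> 0"
    by (auto simp: less_Suc_eq numeral_3_eq_3 expo_def split: if_splits)
  then have "m = var_exp i + (a - (if i = 0 then 1 else 0), b - (if i = 1 then 1 else 0), c - (if i = 2 then 1 else 0))"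
    by (elim disjE) (simp_all add: m var_exp_def)
  then show "\<exists>n. m = var_exp i + n" ..
qed (auto simp: expo_add expo_var_exp)

lemma Xv_factor:
  assumes "\<And>m. lookup a m \<noteq> 0 \<Longrightarrow> \<exists>n. m = var_exp i + n"
  obtains p where "a = Xv i * p"
proof
  have inj: "inj (\<lambda>m. var_exp i + m)" by (auto intro: injI)
  let ?p = "Poly_Mapping.map_key (\<lambda>m. var_exp i + m) a"
  show "a = Xv i * ?p"
  proof (rule poly_mapping_eqI)
    fix m
    show "lookup a m = lookup (Xv i * ?p) m"
    proof (cases "\<exists>n. m = var_exp i + n")
      case True
      then obtain n where n: "m = var_exp i + n" by blast
      show ?thesis unfolding n lookup_Xv_mult by (simp add: map_key.rep_eq inj)
    next
      case False
      then have "lookup (Xv i * ?p) m = 0" by (intro lookup_Xv_mult_eq_0) blast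
      then show ?thesis using assms[of m] False by metis
    qed
  qed
qed

lemma Xv_mult_cancel: "Xv i * p = Xv i * q \<Longrightarrow> p = q"
  by (rule poly_mapping_eqI) (metis lookup_Xv_mult)

lemma homog_Xv_mult_iff: "homog (Suc n) (Xv i * p) \<Longrightarrow> homog n p"
  unfolding homog_lookup by (metis lookup_Xv_mult tdeg_add tdeg_var_exp plus_1_eq_Suc old.nat.inject)

section \<open>Leading monomials\<close>

lemma revlex_irrefl: "\<not> revlex_less m m"
  by (simp add: revlex_less_def)

lemma revlex_trans: "revlex_less a b \<Longrightarrow> revlex_less b c \<Longrightarrow> revlex_less a c"
  by (auto simp: revlex_less_def)

lemma revlex_asym: "revlex_less a b \<Longrightarrow> \<not> revlex_less b a"
  using revlex_trans revlex_irrefl by blast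

lemma revlex_total: "a \<noteq> b \<Longrightarrow> revlex_less a b \<or> revlex_less b a"
  by (cases a; cases b) (auto simp: revlex_less_def tdeg_def)

lemma revlex_add [simp]: "revlex_less (c + a) (c + b) \<longleftrightarrow> revlex_less a b"
  by (simp add: revlex_less_def expo_add)

lemma revlex_max_exists:
  assumes "finite A" "A \<noteq> {}"
  shows "\<exists>m\<in>A. \<forall>m'\<in>A. m' \<noteq> m \<longrightarrow> revlex_less m' m"
  using assms
proof (induction rule: finite_ne_induct)
  case (insert x F)
  then obtain m where m: "m \<in> F" "\<And>m'. m' \<in> F \<Longrightarrow> m' \<noteq> m \<Longrightarrow> revlex_less m' m"
    by blast
  show ?case
    using m insert.hyps revlex_total[of x m] revlex_trans[of _ m x] by (metis insert_iff)
qed auto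

lemma lead_mon_eqI:
  assumes "lookup p m \<noteq> 0" "\<And>m'. revlex_less m m' \<Longrightarrow> lookup p m' = 0"
  shows "lead_mon p = m"
proof -
  have max: "revlex_less m' m" if "m' \<in> Poly_Mapping.keys p" "m' \<noteq> m" for m'
    using assms(2)[of m'] revlex_total[OF that(2)] that(1) by (auto simp: in_keys_iff)
  have m: "m \<in> Poly_Mapping.keys p" using assms(1) by (simp add: in_keys_iff)
  show ?thesis
    unfolding lead_mon_def
  proof (rule the_equality)
    fix n assume "n \<in> Poly_Mapping.keys p \<and> (\<forall>m'\<in>Poly_Mapping.keys p. m' \<noteq> n \<longrightarrow> revlex_less m' n)"
    then show "n = m" using max[of n] m revlex_asym[of n m] by metis
  next
    show "m \<in> Poly_Mapping.keys p \<and> (\<forall>m'\<in>Poly_Mapping.keys p. m' \<noteq> m \<longrightarrow> revlex_less m' m)"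
      using max m by metis
  qed
qed

lemma lead_mon_ex:
  assumes "p \<noteq> 0"
  obtains m where "lead_mon p = m" "lookup p m \<noteq> 0" "\<And>m'. revlex_less m m' \<Longrightarrow> lookup p m' = 0"
proof -
  have "Poly_Mapping.keys p \<noteq> {}"
    using nonzero_lookup[OF assms] by (auto simp: in_keys_iff)
  then obtain m where m: "m \<in> Poly_Mapping.keys p"
    "\<And>m'. m' \<in> Poly_Mapping.keys p \<Longrightarrow> m' \<noteq> m \<Longrightarrow> revlex_less m' m"
    using revlex_max_exists[OF finite_keys] by blast
  have "lookup p m' = 0" if "revlex_less m m'" for m'
    using m(2)[of m'] that revlex_asym revlex_irrefl by (metis in_keys_iff)
  then show ?thesis
    using that[of m] m(1) lead_mon_eqI[of p m] by (simp add: in_keys_iff)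
qed

lemma lookup_lead_mon: "p \<noteq> 0 \<Longrightarrow> lookup p (lead_mon p) \<noteq> 0"
  by (metis lead_mon_ex)

lemma lookup_above_lead_mon: "p \<noteq> 0 \<Longrightarrow> revlex_less (lead_mon p) m \<Longrightarrow> lookup p m = 0"
  by (metis lead_mon_ex)

lemma homog_lead_mon: "homog n p \<Longrightarrow> p \<noteq> 0 \<Longrightarrow> tdeg (lead_mon p) = n"
  using lookup_lead_mon[of p] unfolding homog_lookup by blast

lemma single_1_mult_lead:
  assumes "p \<noteq> 0"
  shows "Poly_Mapping.single n 1 * p \<noteq> 0" "lead_mon (Poly_Mapping.single n 1 * p) = n + lead_mon p"
proof -
  let ?q = "Poly_Mapping.single n 1 * p"
  have nz: "lookup ?q (n + lead_mon p) \<noteq> 0"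
    using lookup_lead_mon[OF assms] by (simp add: lookup_single_mult)
  then show "?q \<noteq> 0" by auto
  show "lead_mon ?q = n + lead_mon p"
  proof (rule lead_mon_eqI[OF nz])
    fix m' assume m': "revlex_less (n + lead_mon p) m'"
    show "lookup ?q m' = 0"
    proof (cases "\<exists>k. m' = n + k")
      case True
      then show ?thesis
        using m' lookup_above_lead_mon[OF assms] by (auto simp: lookup_single_mult)
    qed (metis lookup_single_mult_eq_0)
  qed
qed

lemma mon_dvd_iff: "mon_dvd a b \<longleftrightarrow> (\<exists>n. b = n + a)"
proof
  assume "mon_dvd a b"
  then have *: "\<And>i. i < 3 \<Longrightarrow> expo a i \<le> expo b i"
    by (auto simp: mon_dvd_def)
  have "b = (expo b 0 - expo a 0, expo b 1 - expo a 1, expo b 2 - expo a 2) + a"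
    using *[of 0] *[of 1] *[of 2] by (cases a; cases b) simp
  then show "\<exists>n. b = n + a" ..
qed (auto simp: mon_dvd_def expo_add)

definition lead_set :: "'k::comm_ring_1 poly3 set \<Rightarrow> mon3 set" where
  "lead_set I = {lead_mon p | p. p \<in> I \<and> p \<noteq> 0}"

lemma lead_set_add: "is_ideal I \<Longrightarrow> m \<in> lead_set I \<Longrightarrow> n + m \<in> lead_set I"
  unfolding lead_set_def using single_1_mult_lead is_ideal_mult by (smt (verit) mem_Collect_eq)

text \<open>The component of p in the degree of its leading monomial still has that leading
  monomial, and homogeneity keeps it in I.\<close>

lemma lead_set_homog:
  assumes "homogeneous_ideal I" "m \<in> lead_set I"
  obtains p where "p \<in> I" "p \<noteq> 0" "homog (tdeg m) p" "lead_mon p = m"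
proof -
  obtain p where p: "p \<in> I" "p \<noteq> 0" "lead_mon p = m"
    using assms(2) by (auto simp: lead_set_def)
  let ?q = "hcomp (tdeg m) p"
  have nz: "lookup ?q m \<noteq> 0"
    using lookup_lead_mon[of p] p by (simp add: lookup_hcomp)
  have "lead_mon ?q = m"
    by (rule lead_mon_eqI[OF nz]) (use lookup_above_lead_mon[of p] p in \<open>auto simp: lookup_hcomp\<close>)
  moreover have "?q \<noteq> 0" using nz by auto
  ultimately show ?thesis
    using that[of ?q] homogeneous_ideal_hcomp[OF assms(1) p(1)] by simp
qed

text \<open>The leading monomials of an ideal are closed under multiplication by monomials, so being
  divisible by one of them is the same as being one.\<close>

lemma initial_ideal_eq:
  assumes "is_ideal I"
  shows "initial_ideal I = {q. Poly_Mapping.keys q \<subseteq> lead_set I}"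
proof -
  have "(\<exists>p\<in>I. p \<noteq> 0 \<and> mon_dvd (lead_mon p) m) \<longleftrightarrow> m \<in> lead_set I" for m
  proof
    assume "m \<in> lead_set I"
    then obtain p where "p \<in> I" "p \<noteq> 0" "m = lead_mon p"
      by (auto simp: lead_set_def)
    moreover have "mon_dvd m m" by (simp add: mon_dvd_def)
    ultimately show "\<exists>p\<in>I. p \<noteq> 0 \<and> mon_dvd (lead_mon p) m" by blast
  next
    assume "\<exists>p\<in>I. p \<noteq> 0 \<and> mon_dvd (lead_mon p) m"
    then obtain p n where "p \<in> I" "p \<noteq> 0" "m = n + lead_mon p"
      unfolding mon_dvd_iff by blast
    then show "m \<in> lead_set I"
      using lead_set_add[OF assms, of "lead_mon p" n] by (auto simp: lead_set_def)
  qed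
  then show ?thesis unfolding initial_ideal_def by blast
qed

section \<open>Polynomial functions on matrices\<close>

text \<open>Regular functions on matrices, treated as functions instead of as elements of
  \<open>poly9\<close>: coefficients of moving polynomials are then handled by closure rules.
  \<open>poly_fun_eval9\<close> and \<open>eval9_poly_fun\<close> translate in both directions where
  \<open>gin\<close> requires it.\<close>

inductive poly_fun :: "((nat \<Rightarrow> nat \<Rightarrow> 'k::comm_ring_1) \<Rightarrow> 'k) \<Rightarrow> bool" where
  poly_fun_const: "poly_fun (\<lambda>g. c)"
| poly_fun_entry: "i < 3 \<Longrightarrow> j < 3 \<Longrightarrow> poly_fun (\<lambda>g. g i j)"
| poly_fun_add: "poly_fun f \<Longrightarrow> poly_fun h \<Longrightarrow> poly_fun (\<lambda>g. f g + h g)"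
| poly_fun_mult: "poly_fun f \<Longrightarrow> poly_fun h \<Longrightarrow> poly_fun (\<lambda>g. f g * h g)"

lemma poly_fun_uminus: "poly_fun f \<Longrightarrow> poly_fun (\<lambda>g. - f g)"
  using poly_fun_mult[OF poly_fun_const[of "- 1"]] by fastforce

lemma poly_fun_diff: "poly_fun f \<Longrightarrow> poly_fun h \<Longrightarrow> poly_fun (\<lambda>g. f g - h g)"
  using poly_fun_add[OF _ poly_fun_uminus] by fastforce

lemma poly_fun_sum: "(\<And>x. x \<in> A \<Longrightarrow> poly_fun (f x)) \<Longrightarrow> poly_fun (\<lambda>g. \<Sum>x\<in>A. f x g)"
  by (induction A rule: infinite_finite_induct) (auto intro: poly_fun.intros)

lemma poly_fun_prod: "(\<And>x. x \<in> A \<Longrightarrow> poly_fun (f x)) \<Longrightarrow> poly_fun (\<lambda>g. \<Prod>x\<in>A. f x g)"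
  by (induction A rule: infinite_finite_induct) (auto intro: poly_fun.intros)

lemma poly_fun_power: "poly_fun f \<Longrightarrow> poly_fun (\<lambda>g. f g ^ n)"
  by (induction n) (auto intro: poly_fun.intros)

lemma poly_fun_det3: "poly_fun det3"
proof -
  have "poly_fun (\<lambda>g. g 0 0 * (g 1 1 * g 2 2 - g 1 2 * g 2 1)
          - g 0 1 * (g 1 0 * g 2 2 - g 1 2 * g 2 0)
          + g 0 2 * (g 1 0 * g 2 1 - g 1 1 * g 2 0) :: 'a)"
    by (intro poly_fun_add poly_fun_diff poly_fun_mult poly_fun_entry) simp_all
  then show ?thesis by (simp add: det3_def[abs_def])
qed

lemma poly_fun_line:
  "poly_fun f \<Longrightarrow> \<exists>q. \<forall>t. f (\<lambda>i j. A i j + t * B i j) = poly q t"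
proof (induction rule: poly_fun.induct)
  case (poly_fun_const c)
  show ?case by (rule exI[of _ "[:c:]"]) simp
next
  case (poly_fun_entry i j)
  show ?case by (rule exI[of _ "[:A i j, B i j:]"]) simp
next
  case (poly_fun_add f h)
  then show ?case by (metis poly_add)
next
  case (poly_fun_mult f h)
  then show ?case by (metis poly_mult)
qed

text \<open>Nonempty open sets meet. On the line through g1 (t = 0) and g2 (t = 1) both functions
  become nonzero univariate polynomials, whose product has finitely many roots in an infinite
  field.\<close>

lemma poly_fun_nonzero_mult:
  fixes f h :: "(nat \<Rightarrow> nat \<Rightarrow> 'k::field_char_0) \<Rightarrow> 'k"
  assumes "poly_fun f" "poly_fun h" "f g1 \<noteq> 0" "h g2 \<noteq> 0"
  obtains g where "f g \<noteq> 0" "h g \<noteq> 0"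
proof -
  let ?l = "\<lambda>t i j. g1 i j + t * (g2 i j - g1 i j)"
  obtain p where p: "\<And>t. f (?l t) = poly p t"
    using poly_fun_line[OF assms(1), of g1 "\<lambda>i j. g2 i j - g1 i j"] by blast
  obtain q where q: "\<And>t. h (?l t) = poly q t"
    using poly_fun_line[OF assms(2), of g1 "\<lambda>i j. g2 i j - g1 i j"] by blast
  have "p \<noteq> 0" "q \<noteq> 0" using p[of 0] q[of 1] assms by auto
  then have "p * q \<noteq> 0" by simp
  then have "finite {t. poly (p * q) t = 0}" by (rule poly_roots_finite)
  then obtain t where "poly (p * q) t \<noteq> 0"
    using ex_new_if_finite[OF infinite_UNIV_char_0] by blast
  then show ?thesis using that[of "?l t"] p q by simp
qed

lemma poly_fun_nonzero_prod:
  fixes f :: "'b \<Rightarrow> (nat \<Rightarrow> nat \<Rightarrow> 'k::field_char_0) \<Rightarrow> 'k"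
  assumes "finite A" "\<And>x. x \<in> A \<Longrightarrow> poly_fun (f x)" "\<And>x. x \<in> A \<Longrightarrow> \<exists>g. f x g \<noteq> 0"
  shows "\<exists>g. \<forall>x\<in>A. f x g \<noteq> 0"
  using assms
proof (induction rule: finite_induct)
  case (insert x F)
  then obtain g1 g2 where g: "f x g1 \<noteq> 0" "\<forall>x\<in>F. f x g2 \<noteq> 0" by blast
  have "poly_fun (\<lambda>g. \<Prod>x\<in>F. f x g)" by (rule poly_fun_prod) (use insert in auto)
  then obtain g where fg: "f x g \<noteq> 0" "(\<Prod>x\<in>F. f x g) \<noteq> 0"
    by (rule poly_fun_nonzero_mult[rotated, of _ "f x" g1 g2])
      (use g insert.prems(1)[of x] insert.hyps(1) in simp_all)
  then have "f y g \<noteq> 0" if "y \<in> F" for y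
    using that insert.hyps(1) by simp
  then show ?case using fg(1) by blast
qed auto

section \<open>Formal polynomials in the nine entries versus polynomial functions\<close>

definition eval_mon9 :: "(nat \<Rightarrow> nat \<Rightarrow> 'k::comm_ring_1) \<Rightarrow> (nat \<times> nat \<Rightarrow>\<^sub>0 nat) \<Rightarrow> 'k" where
  "eval_mon9 g m = (\<Prod>v\<in>Poly_Mapping.keys m. g (fst v) (snd v) ^ lookup m v)"

lemma eval9_eq: "eval9 f g = monomial_ext (\<lambda>c. c) (eval_mon9 g) f"
  by (simp add: eval9_def monomial_ext_def eval_mon9_def)

lemma eval_mon9_superset:
  assumes "finite A" "Poly_Mapping.keys m \<subseteq> A"
  shows "eval_mon9 g m = (\<Prod>v\<in>A. g (fst v) (snd v) ^ lookup m v)"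
  unfolding eval_mon9_def
  by (rule prod.mono_neutral_left) (use assms in \<open>auto simp: in_keys_iff\<close>)

lemma eval_mon9_add: "eval_mon9 g (m + n) = eval_mon9 g m * eval_mon9 g n"
proof -
  let ?A = "Poly_Mapping.keys m \<union> Poly_Mapping.keys n"
  show ?thesis
    using eval_mon9_superset[of ?A m g] eval_mon9_superset[of ?A n g]
      eval_mon9_superset[of ?A "m + n" g] keys_add[of m n]
    by (simp add: lookup_add power_add prod.distrib)
qed

lemma eval9_add: "eval9 (p + q) g = eval9 p g + eval9 q g"
  unfolding eval9_eq by (rule monomial_ext_add) simp_all

lemma eval9_mult: "eval9 (p * q) g = eval9 p g * eval9 q g"
  unfolding eval9_eq by (rule monomial_ext_mult) (simp_all add: eval_mon9_add)

lemma poly_fun_eval9: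
  assumes "poly_fun f"
  shows "\<exists>p. matrix_poly p \<and> (\<forall>g. eval9 p g = f g)"
  using assms
proof (induction rule: poly_fun.induct)
  case (poly_fun_const c)
  show ?case
    by (rule exI[of _ "Poly_Mapping.single 0 c"])
      (simp add: matrix_poly_def eval9_eq monomial_ext_single eval_mon9_def)
next
  case (poly_fun_entry i j)
  then show ?case
    by (intro exI[of _ "Poly_Mapping.single (Poly_Mapping.single (i, j) 1) 1"])
      (simp add: matrix_poly_def eval9_eq monomial_ext_single eval_mon9_def)
next
  case (poly_fun_add f h)
  then obtain p q where pq: "matrix_poly p" "matrix_poly q" "\<forall>g. eval9 p g = f g" "\<forall>g. eval9 q g = h g"
    by blast
  have "matrix_poly (p + q)"
    using pq(1,2) keys_add[of p q] unfolding matrix_poly_def by blast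
  then show ?case using pq(3,4) eval9_add by metis
next
  case (poly_fun_mult f h)
  then obtain p q where pq: "matrix_poly p" "matrix_poly q" "\<forall>g. eval9 p g = f g" "\<forall>g. eval9 q g = h g"
    by blast
  have "matrix_poly (p * q)"
    unfolding matrix_poly_def
  proof
    fix m assume "m \<in> Poly_Mapping.keys (p * q)"
    then obtain a b where ab: "m = a + b" "a \<in> Poly_Mapping.keys p" "b \<in> Poly_Mapping.keys q"
      using keys_mult[of p q] by blast
    then show "Poly_Mapping.keys m \<subseteq> {..<3} \<times> {..<3}"
      using pq(1,2) keys_add[of a b] unfolding matrix_poly_def by blast
  qed
  then show ?case using pq(3,4) eval9_mult by metis
qed

lemma eval9_poly_fun:
  assumes "matrix_poly p"
  shows "poly_fun (eval9 p)"
proof -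
  have "poly_fun (\<lambda>g. \<Sum>m\<in>Poly_Mapping.keys p. lookup p m *
      (\<Prod>v\<in>Poly_Mapping.keys m. g (fst v) (snd v) ^ lookup m v))"
    by (intro poly_fun_sum poly_fun_mult poly_fun_const poly_fun_prod poly_fun_power poly_fun_entry)
      (use assms in \<open>force simp: matrix_poly_def\<close>)+
  then show ?thesis by (simp add: eval9_def[abs_def])
qed

lemma digits_unique:
  fixes B :: nat
  assumes "\<And>k. k < n \<Longrightarrow> a k < B" "\<And>k. k < n \<Longrightarrow> b k < B"
    "(\<Sum>k<n. a k * B ^ k) = (\<Sum>k<n. b k * B ^ k)" "k < n"
  shows "a k = b k"
  using assms
proof (induction n arbitrary: a b k)
  case (Suc n)
  have shift: "(\<Sum>k<Suc n. c k * B ^ k) = c 0 + B * (\<Sum>k<n. c (Suc k) * B ^ k)" for c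
    by (simp only: sum.lessThan_Suc_shift sum_distrib_left) (simp add: ac_simps)
  have eq: "a 0 + B * (\<Sum>k<n. a (Suc k) * B ^ k) = b 0 + B * (\<Sum>k<n. b (Suc k) * B ^ k)"
    using Suc.prems(3) by (simp only: shift)
  have lt: "a 0 < B" "b 0 < B" using Suc.prems by auto
  have "(a 0 + B * (\<Sum>k<n. a (Suc k) * B ^ k)) mod B = (b 0 + B * (\<Sum>k<n. b (Suc k) * B ^ k)) mod B"
    using eq by simp
  then have 0: "a 0 = b 0" using lt by simp
  then have "(\<Sum>k<n. a (Suc k) * B ^ k) = (\<Sum>k<n. b (Suc k) * B ^ k)"
    using eq lt by simp
  then have "a (Suc k) = b (Suc k)" if "k < n" for k
    using Suc.IH[of "\<lambda>k. a (Suc k)" "\<lambda>k. b (Suc k)" k] Suc.prems(1,2) that by simp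
  then show ?case using 0 Suc.prems(4) by (cases k) auto
qed simp

text \<open>Kronecker substitution: for a base B exceeding all exponents, sending the entry (i,j) to
  t^(B^(3i+j)) separates the monomials of p.\<close>

lemma eval9_nonzero:
  fixes p :: "'k::field_char_0 poly9"
  assumes p: "matrix_poly p" "p \<noteq> 0"
  shows "\<exists>g. eval9 p g \<noteq> 0"
proof -
  define S where "S = (\<Union>m\<in>Poly_Mapping.keys p. lookup m ` Poly_Mapping.keys m)"
  have "finite S" by (auto simp: S_def)
  then have B0: "\<And>x. x \<in> S \<Longrightarrow> x \<le> Max S" by (rule Max_ge)
  define B where "B = Suc (Max S)"
  have B: "lookup m v < B" if "m \<in> Poly_Mapping.keys p" for m v
  proof (cases "v \<in> Poly_Mapping.keys m")
    case True
    then have "lookup m v \<in> S" unfolding S_def using that by blast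
    then show ?thesis using B0 by (simp add: B_def le_imp_less_Suc)
  qed (simp add: in_keys_iff B_def)
  \<comment> \<open>The index k = 3i + j enumerates the nine entries, with i = k div 3 and j = k mod
    3; the exponents of m become the base B digits of \<open>E m\<close>.\<close>
  define E :: "(nat \<times> nat \<Rightarrow>\<^sub>0 nat) \<Rightarrow> nat"
    where "E m = (\<Sum>k<9. lookup m (k div 3, k mod 3) * B ^ k)" for m
  have inj: "m = n" if mn: "m \<in> Poly_Mapping.keys p" "n \<in> Poly_Mapping.keys p" "E m = E n" for m n
  proof (rule poly_mapping_eqI)
    fix v
    show "lookup m v = lookup n v"
    proof (cases "v \<in> {..<3} \<times> {..<3}")
      case True
      then have v: "fst v < 3" "snd v < 3" by auto
      let ?k = "3 * fst v + snd v"
      have k: "?k div 3 = fst v" "?k mod 3 = snd v" "?k < 9" using v by auto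
      have "lookup m (?k div 3, ?k mod 3) = lookup n (?k div 3, ?k mod 3)"
        by (rule digits_unique[where a = "\<lambda>k. lookup m (k div 3, k mod 3)" and n = 9 and B = B
              and b = "\<lambda>k. lookup n (k div 3, k mod 3)", OF B[OF mn(1)] B[OF mn(2)] mn(3)[unfolded E_def] k(3)])
      then show ?thesis unfolding k by simp
    next
      case False
      then show ?thesis using p(1) mn unfolding matrix_poly_def by (metis in_keys_iff subsetD)
    qed
  qed
  define q where "q = (\<Sum>m\<in>Poly_Mapping.keys p. Polynomial.monom (lookup p m) (E m))"
  have ev: "eval9 p (\<lambda>i j. t ^ (B ^ (3 * i + j))) = poly q t" for t
  proof -
    have "eval_mon9 (\<lambda>i j. t ^ (B ^ (3 * i + j))) m = t ^ E m" if "m \<in> Poly_Mapping.keys p" for m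
    proof -
      have sub: "Poly_Mapping.keys m \<subseteq> {..<3} \<times> {..<3}" using p(1) that by (auto simp: matrix_poly_def)
      have bij: "bij_betw (\<lambda>k. (k div 3, k mod 3)) {..<9} ({..<3} \<times> {..<3::nat})"
        by (rule bij_betw_byWitness[where f' = "\<lambda>v. 3 * fst v + snd v"]) auto
      have "eval_mon9 (\<lambda>i j. t ^ (B ^ (3 * i + j))) m
          = (\<Prod>v\<in>{..<3} \<times> {..<3}. t ^ (B ^ (3 * fst v + snd v) * lookup m v))"
        by (simp add: eval_mon9_superset[OF _ sub] power_mult)
      also have "\<dots> = (\<Prod>k<9. t ^ (B ^ (3 * fst (k div 3, k mod 3) + snd (k div 3, k mod 3)) * lookup m (k div 3, k mod 3)))"
        by (rule prod.reindex_bij_betw[OF bij, symmetric])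
      also have "\<dots> = t ^ E m"
        unfolding E_def power_sum by (rule prod.cong) (simp_all add: mult.commute)
      finally show ?thesis .
    qed
    then show ?thesis
      by (simp add: eval9_eq monomial_ext_def q_def poly_sum poly_monom)
  qed
  obtain m where m: "m \<in> Poly_Mapping.keys p"
    using nonzero_lookup[OF p(2)] by (auto simp: in_keys_iff)
  \<comment> \<open>As \<open>E\<close> is injective on the monomials of p, no terms of q cancel or
    merge.\<close>
  have "coeff q (E m) = (\<Sum>n\<in>Poly_Mapping.keys p. if n = m then lookup p m else 0)"
    unfolding q_def coeff_sum by (rule sum.cong) (use inj m in auto)
  also have "\<dots> = lookup p m" using m by simp
  finally have "q \<noteq> 0" using m by (auto simp: in_keys_iff)
  then have "finite {t. poly q t = 0}" by (rule poly_roots_finite)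
  then obtain t where "poly q t \<noteq> 0"
    using ex_new_if_finite[OF infinite_UNIV_char_0] by blast
  then show ?thesis using ev by metis
qed

lemma det3_nonzero_exists: "\<exists>g. det3 g \<noteq> (0 :: 'k::comm_ring_1)"
  by (rule exI[of _ "\<lambda>i j. if i = j then 1 else 0"]) (simp add: det3_def)

text \<open>The further factor \<open>F\<close> lets the three powers occurring in a monomial be
  attached one after another. Each single multiplication by a linear form only shifts coefficients
  and weights them with entries of g.\<close>

lemma poly_fun_linear_form_power:
  fixes F :: "(nat \<Rightarrow> nat \<Rightarrow> 'k::comm_ring_1) \<Rightarrow> 'k poly3"
  assumes "\<And>m. poly_fun (\<lambda>g. lookup (F g) m)" "j < 3"
  shows "poly_fun (\<lambda>g. lookup (linear_form g j ^ n * F g) m)"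
proof (induction n arbitrary: m)
  case (Suc n)
  let ?G = "\<lambda>g. linear_form g j ^ n * F g"
  have "poly_fun (\<lambda>g. lookup (Xv i * ?G g) m)" for i
  proof (cases "\<exists>k. m = var_exp i + k")
    case True
    then show ?thesis using Suc by (auto simp: lookup_Xv_mult)
  next
    case False
    then have "lookup (Xv i * ?G g) m = 0" for g by (intro lookup_Xv_mult_eq_0) blast
    then show ?thesis by (simp add: poly_fun_const)
  qed
  moreover have "lookup (linear_form g j * ?G g) m = (\<Sum>i<3. g i j * lookup (Xv i * ?G g) m)" for g
    by (simp add: linear_form_def sum_distrib_right lookup_sum mult.assoc)
  ultimately have "poly_fun (\<lambda>g. lookup (linear_form g j * ?G g) m)"
    using assms(2) by (auto intro!: poly_fun_sum poly_fun_mult poly_fun_entry)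
  then show ?case by (simp add: mult.assoc)
qed (use assms in simp)

lemma poly_fun_subst3: "poly_fun (\<lambda>g. lookup (subst3 (linear_form g) p) m)"
proof (induction p arbitrary: m rule: poly_mapping_monomial_induct)
  case (single n c)
  \<comment> \<open>The trailing 1 is the constant \<open>F\<close> from which the three
    applications of the preceding lemma start.\<close>
  have "poly_fun (\<lambda>g. c * lookup (linear_form g 0 ^ expo n 0 * (linear_form g 1 ^ expo n 1 *
      (linear_form g 2 ^ expo n 2 * 1))) m)"
    by (intro poly_fun_mult poly_fun_const poly_fun_linear_form_power) simp_all
  then show ?case by (simp add: subst3_single mult.assoc)
qed (simp_all add: subst3_add lookup_add poly_fun_const poly_fun_add)

section \<open>Generic initial ideals\<close>

text \<open>These closure rules hold for every matrix g. For a singular g the image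
  \<open>act g I\<close> is guaranteed only to be a vector space, and echelon families range over
  all g, so nothing beyond scalar multiples and sums may be used there.\<close>

lemma act_add: "is_ideal I \<Longrightarrow> p \<in> act g I \<Longrightarrow> q \<in> act g I \<Longrightarrow> p + q \<in> act g I"
  by (auto simp: act_eq simp flip: subst3_add intro: is_ideal_add)

lemma act_const3_mult: "is_ideal I \<Longrightarrow> p \<in> act g I \<Longrightarrow> const3 c * p \<in> act g I"
proof -
  assume I: "is_ideal I" and "p \<in> act g I"
  then obtain q where q: "q \<in> I" "p = subst3 (linear_form g) q" by (auto simp: act_eq)
  then have "const3 c * p = subst3 (linear_form g) (const3 c * q)" by (simp add: subst3_mult)
  then show ?thesis using is_ideal_mult[OF I q(1)] by (auto simp: act_eq)
qed

lemma act_0: "is_ideal I \<Longrightarrow> 0 \<in> act g I"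
  using is_ideal_0[of I] subst3_0 unfolding act_eq by (metis image_eqI)

lemma act_diff: "is_ideal I \<Longrightarrow> p \<in> act g I \<Longrightarrow> q \<in> act g I \<Longrightarrow> p - q \<in> act g I"
  using act_add[of I p g "const3 (- 1) * q"] act_const3_mult[of I q g "- 1"]
  by (simp add: const3_uminus)

lemma act_sum: "is_ideal I \<Longrightarrow> (\<And>x. x \<in> A \<Longrightarrow> f x \<in> act g I) \<Longrightarrow> (\<Sum>x\<in>A. f x) \<in> act g I"
  by (induction A rule: infinite_finite_induct) (auto intro: act_add act_0)

text \<open>A reduced echelon family for the degree e part of all g I at once, cleared of denominators:
  P is the set of pivots, D the common pivot value.\<close>

definition echelon :: "'k::field_char_0 poly3 set \<Rightarrow> nat \<Rightarrow> mon3 set \<Rightarrow>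
    ((nat \<Rightarrow> nat \<Rightarrow> 'k) \<Rightarrow> 'k) \<Rightarrow> (mon3 \<Rightarrow> (nat \<Rightarrow> nat \<Rightarrow> 'k) \<Rightarrow> 'k poly3) \<Rightarrow> bool" where
  "echelon I e P D F \<longleftrightarrow> P \<subseteq> {m. tdeg m = e} \<and> poly_fun D \<and> (\<exists>g. D g \<noteq> 0) \<and>
    (\<forall>w\<in>P. \<forall>g. F w g \<in> act g I \<and> homog e (F w g)) \<and>
    (\<forall>w\<in>P. \<forall>m. poly_fun (\<lambda>g. lookup (F w g) m)) \<and>
    (\<forall>w\<in>P. \<forall>g m. revlex_less w m \<longrightarrow> lookup (F w g) m = 0) \<and>
    (\<forall>w\<in>P. \<forall>w'\<in>P. \<forall>g. lookup (F w g) w' = (if w' = w then D g else 0))"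

text \<open>Completeness of the family: where \<open>D g\<close> is nonzero, it spans the degree e
  part of g I. Comparing entries at the pivots forces the coefficients, so spanning can be stated as
  an identity free of denominators, valid for all g.\<close>

definition full_echelon :: "'k::field_char_0 poly3 set \<Rightarrow> nat \<Rightarrow> mon3 set \<Rightarrow>
    ((nat \<Rightarrow> nat \<Rightarrow> 'k) \<Rightarrow> 'k) \<Rightarrow> (mon3 \<Rightarrow> (nat \<Rightarrow> nat \<Rightarrow> 'k) \<Rightarrow> 'k poly3) \<Rightarrow> bool" where
  "full_echelon I e P D F \<longleftrightarrow> echelon I e P D F \<and>
    (\<forall>v\<in>I. homog e v \<longrightarrow> (\<forall>g. const3 (D g) * subst3 (linear_form g) v
      = (\<Sum>w\<in>P. const3 (lookup (subst3 (linear_form g) v) w) * F w g)))"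

lemma echelon_finite: "echelon I e P D F \<Longrightarrow> finite P"
  using finite_subset[OF _ finite_tdeg] by (auto simp: echelon_def)

text \<open>One step of fraction-free Gaussian elimination, carried out for all g simultaneously: a
  vector v violating completeness supplies a new pivot.\<close>

lemma echelon_extend:
  assumes I: "is_ideal I" and ech: "echelon I e P D F" and v: "v \<in> I" "homog e v"
    and ne: "const3 (D g0) * subst3 (linear_form g0) v
      \<noteq> (\<Sum>w\<in>P. const3 (lookup (subst3 (linear_form g0) v) w) * F w g0)"
  shows "\<exists>c D' F'. c \<notin> P \<and> echelon I e (insert c P) D' F'"
proof -
  note fin = echelon_finite[OF ech]
  have P: "\<And>w. w \<in> P \<Longrightarrow> tdeg w = e" and D: "poly_fun D" "\<exists>g. D g \<noteq> 0"
    and Fact: "\<And>w g. w \<in> P \<Longrightarrow> F w g \<in> act g I" and Fhom: "\<And>w g. w \<in> P \<Longrightarrow> homog e (F w g)"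
    and Fpf: "\<And>w m. w \<in> P \<Longrightarrow> poly_fun (\<lambda>g. lookup (F w g) m)"
    and Fab: "\<And>w g m. w \<in> P \<Longrightarrow> revlex_less w m \<Longrightarrow> lookup (F w g) m = 0"
    and Fpiv: "\<And>w w' g. w \<in> P \<Longrightarrow> w' \<in> P \<Longrightarrow> lookup (F w g) w' = (if w' = w then D g else 0)"
    using ech unfolding echelon_def by auto
  define S where "S g = subst3 (linear_form g) v" for g
  \<comment> \<open>The image of v reduced against the old pivots, so that all its entries at
    \<open>P\<close> vanish.\<close>
  define V where "V g = const3 (D g) * S g - (\<Sum>w\<in>P. const3 (lookup (S g) w) * F w g)" for g
  have Sact: "S g \<in> act g I" for g using v by (auto simp: S_def act_eq)
  have Shom: "homog e (S g)" for g using homog_subst3 v by (auto simp: S_def)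
  have Spf: "poly_fun (\<lambda>g. lookup (S g) m)" for m unfolding S_def by (rule poly_fun_subst3)
  have Vact: "V g \<in> act g I" for g
    unfolding V_def by (intro act_diff act_sum act_const3_mult I Sact Fact)
  have Vhom: "homog e (V g)" for g
    unfolding V_def by (intro homog_diff homog_sum homog_const3_mult Shom Fhom)
  have Vlook: "lookup (V g) m = D g * lookup (S g) m - (\<Sum>w\<in>P. lookup (S g) w * lookup (F w g) m)" for g m
    by (simp add: V_def lookup_minus lookup_sum)
  have Vpf: "poly_fun (\<lambda>g. lookup (V g) m)" for m
    unfolding Vlook by (intro poly_fun_diff poly_fun_sum poly_fun_mult D Spf Fpf)
  have VP: "lookup (V g) w' = 0" if "w' \<in> P" for g w'
  proof -
    have "(\<Sum>w\<in>P. lookup (S g) w * lookup (F w g) w') = (\<Sum>w\<in>P. if w = w' then lookup (S g) w' * D g else 0)"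
      by (rule sum.cong) (use that Fpiv in auto)
    then show ?thesis using that fin by (simp add: Vlook)
  qed
  \<comment> \<open>A monomial counts as soon as its coefficient is nonzero for some g. The largest
    one is therefore a pivot chosen uniformly, although for special g the leading monomial of
    \<open>V g\<close> can be smaller.\<close>
  define C where "C = {m. \<exists>g. lookup (V g) m \<noteq> 0}"
  have "C \<subseteq> {m. tdeg m = e}" using Vhom unfolding C_def homog_lookup by blast
  then have "finite C" by (rule finite_subset) (rule finite_tdeg)
  moreover have "C \<noteq> {}"
  proof -
    have "V g0 \<noteq> 0" using ne by (simp add: V_def S_def)
    then obtain m where "lookup (V g0) m \<noteq> 0" using nonzero_lookup by blast
    then show ?thesis unfolding C_def by blast
  qed
  ultimately have "\<exists>c\<in>C. \<forall>m\<in>C. m \<noteq> c \<longrightarrow> revlex_less m c" by (rule revlex_max_exists)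
  then obtain c where c: "c \<in> C" "\<And>m. m \<in> C \<Longrightarrow> m \<noteq> c \<Longrightarrow> revlex_less m c" by blast
  have Vab: "lookup (V g) m = 0" if "revlex_less c m" for g m
  proof (rule ccontr)
    assume "lookup (V g) m \<noteq> 0"
    then have "m \<in> C" unfolding C_def by blast
    then show False using c(2)[of m] that revlex_asym revlex_irrefl by metis
  qed
  have cP: "c \<notin> P" using c(1) VP unfolding C_def by blast
  have tc: "tdeg c = e" using c(1) \<open>C \<subseteq> {m. tdeg m = e}\<close> by auto
  define E where "E g = lookup (V g) c" for g
  \<comment> \<open>Cross-multiplication clears the entry at c in the old vectors; scaling
    \<open>V\<close> by \<open>D\<close> gives the new vector the same pivot value
    \<open>D g * E g\<close> as the others.\<close>
  define F' where "F' w g = (if w = c then const3 (D g) * V g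
      else const3 (E g) * F w g - const3 (lookup (F w g) c) * V g)" for w g
  have Epf: "poly_fun E" unfolding E_def[abs_def] by (rule Vpf)
  obtain g1 g2 where "D g1 \<noteq> 0" "E g2 \<noteq> 0" using D(2) c(1) unfolding C_def E_def by blast
  then obtain g where "D g \<noteq> 0" "E g \<noteq> 0"
    using poly_fun_nonzero_mult[OF D(1) Epf] by metis
  then have nz: "\<exists>g. D g * E g \<noteq> 0" by auto
  have F'look: "lookup (F' w g) m = (if w = c then D g * lookup (V g) m
      else E g * lookup (F w g) m - lookup (F w g) c * lookup (V g) m)" for w g m
    by (simp add: F'_def lookup_minus)
  have "echelon I e (insert c P) (\<lambda>g. D g * E g) F'"
    unfolding echelon_def
  proof (intro conjI ballI allI impI)
    show "insert c P \<subseteq> {m. tdeg m = e}" using P tc by auto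
    show "poly_fun (\<lambda>g. D g * E g)" by (intro poly_fun_mult D Epf)
    show "\<exists>g. D g * E g \<noteq> 0" by (rule nz)
  next
    fix w g assume w: "w \<in> insert c P"
    show "F' w g \<in> act g I" "homog e (F' w g)"
      using w by (auto simp: F'_def intro!: act_const3_mult act_diff homog_diff homog_const3_mult I Vact Vhom Fact Fhom)
  next
    fix w m assume w: "w \<in> insert c P"
    show "poly_fun (\<lambda>g. lookup (F' w g) m)"
    proof (cases "w = c")
      case True
      then show ?thesis unfolding F'look by (simp add: poly_fun_mult D Vpf)
    next
      case False
      then show ?thesis unfolding F'look using w
        by (auto intro!: poly_fun_diff poly_fun_mult Epf Vpf Fpf)
    qed
  next
    fix w g m assume w: "w \<in> insert c P" and m: "revlex_less w m"
    show "lookup (F' w g) m = 0"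
    proof (cases "w = c")
      case True
      then show ?thesis using Vab m by (simp add: F'look)
    next
      case False
      then have wP: "w \<in> P" using w by simp
      \<comment> \<open>Either c lies above w, and \<open>F w g\<close> vanishes at c, or c lies
        below w and hence below m, and \<open>V g\<close> vanishes at m.\<close>
      have "lookup (F w g) c = 0 \<or> lookup (V g) m = 0"
        using revlex_total[OF False] Fab[OF wP] Vab revlex_trans[OF _ m] by metis
      then show ?thesis using False Fab[OF wP m, of g] by (auto simp: F'look)
    qed
  next
    fix w w' g assume w: "w \<in> insert c P" "w' \<in> insert c P"
    show "lookup (F' w g) w' = (if w' = w then D g * E g else 0)"
    proof (cases "w = c")
      case True
      then show ?thesis using w(2) cP VP[of w' g] by (cases "w' = c") (simp_all add: F'look E_def)
    next
      case False
      then have "w \<in> P" using w(1) by simp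
      then show ?thesis using w(2) cP False VP[of w' g] Fpiv[of w w' g]
        by (cases "w' = c") (simp_all add: F'look E_def)
    qed
  qed
  then show ?thesis using cP by blast
qed

text \<open>Take an echelon family with the most pivots; their number is bounded by the number of
  monomials of degree e. If it were incomplete, it could be extended.\<close>

lemma full_echelon_exists:
  assumes I: "is_ideal I"
  shows "\<exists>P D F. full_echelon I e P D F"
proof -
  let ?Q = "\<lambda>P. \<exists>D F. echelon I e P D F"
  have "echelon I e {} (\<lambda>_. 1) (\<lambda>_ _. 0)"
    by (simp add: echelon_def poly_fun_const)
  then have "?Q {}" by blast
  moreover have "\<forall>P. ?Q P \<longrightarrow> card P < Suc (card {m. tdeg m = e})"
    using card_mono[OF finite_tdeg[of e]] by (force simp: echelon_def less_Suc_eq_le)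
  ultimately obtain P where P: "?Q P" "\<And>P'. ?Q P' \<Longrightarrow> card P' \<le> card P"
    using ex_has_greatest_nat[of ?Q "{}" card "Suc (card {m. tdeg m = e})"] by blast
  then obtain D F where ech: "echelon I e P D F" by blast
  have "const3 (D g) * subst3 (linear_form g) v
      = (\<Sum>w\<in>P. const3 (lookup (subst3 (linear_form g) v) w) * F w g)" if v: "v \<in> I" "homog e v" for v g
  proof (rule ccontr)
    assume "\<not> ?thesis"
    then obtain c D' F' where c: "c \<notin> P" "echelon I e (insert c P) D' F'"
      using echelon_extend[OF I ech v] by blast
    then have "card (insert c P) \<le> card P" using P(2) by blast
    then show False using c(1) echelon_finite[OF ech] by simp
  qed
  then show ?thesis using ech unfolding full_echelon_def by blast
qed

text \<open>\<open>P\<close> does not depend on g, so this makes the degree e part of in(g I)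
  constant on an open set.\<close>

lemma full_echelon_lead:
  assumes I: "homogeneous_ideal I" and ech: "full_echelon I e P D F"
    and g: "D g \<noteq> 0" "det3 g \<noteq> 0" and m: "tdeg m = e"
  shows "m \<in> lead_set (act g I) \<longleftrightarrow> m \<in> P"
proof
  have e: "echelon I e P D F" using ech by (simp add: full_echelon_def)
  have Fab: "\<And>w m. w \<in> P \<Longrightarrow> revlex_less w m \<Longrightarrow> lookup (F w g) m = 0"
    and Fact: "\<And>w. w \<in> P \<Longrightarrow> F w g \<in> act g I"
    and Fpiv: "\<And>w w'. w \<in> P \<Longrightarrow> w' \<in> P \<Longrightarrow> lookup (F w g) w' = (if w' = w then D g else 0)"
    using e unfolding echelon_def by auto
  {
    assume "m \<in> P"
    then have nz: "lookup (F m g) m \<noteq> 0" using Fpiv g by simp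
    then have "lead_mon (F m g) = m" using Fab \<open>m \<in> P\<close> by (intro lead_mon_eqI) auto
    moreover have "F m g \<noteq> 0" using nz by auto
    ultimately show "m \<in> lead_set (act g I)"
      using Fact[OF \<open>m \<in> P\<close>] by (force simp: lead_set_def)
  }
  assume "m \<in> lead_set (act g I)"
  then obtain p where p: "p \<in> act g I" "p \<noteq> 0" "homog e p" "lead_mon p = m"
    using lead_set_homog[OF homogeneous_ideal_act[OF I g(2)]] m by metis
  obtain q where q: "q \<in> I" "p = subst3 (linear_form g) q" using p(1) by (auto simp: act_eq)
  have "subst3 (linear_form g) (hcomp e q) = p"
    using hcomp_homog[OF p(3), of e] by (simp add: q(2) flip: hcomp_subst3)
  then have eq: "const3 (D g) * p = (\<Sum>w\<in>P. const3 (lookup p w) * F w g)"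
    using ech homogeneous_ideal_hcomp[OF I q(1), of e] unfolding full_echelon_def by fastforce
  show "m \<in> P"
  proof (rule ccontr)
    assume mP: "m \<notin> P"
    \<comment> \<open>A pivot above the leading monomial m has coefficient 0 in p; for a pivot w
      below m, \<open>F w g\<close> vanishes at m.\<close>
    have "lookup p w * lookup (F w g) m = 0" if "w \<in> P" for w
      using that mP Fab[of w m] revlex_total[of w m] lookup_above_lead_mon[OF p(2), of w] p(4)
      by (metis mult_eq_0_iff)
    then have "lookup (\<Sum>w\<in>P. const3 (lookup p w) * F w g) m = 0"
      by (simp add: lookup_sum sum.neutral)
    then have "D g * lookup p m = 0" by (simp flip: eq)
    then show False using g(1) lookup_lead_mon[OF p(2)] p(4) by simp
  qed
qed

subsection \<open>Polynomial curves in a subspace\<close>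

text \<open>Takes the place of a Vandermonde argument. Passing from G(t) to G(2t) - 2^(n+1) G(t)
  removes the top coefficient and multiplies the k-th one by 2^k - 2^(n+1), which is invertible in
  characteristic 0; induction on n then applies.\<close>

lemma curve_coefficients:
  fixes a :: "nat \<Rightarrow> 'k::field_char_0 poly3"
  assumes W: "is_ideal W" and "\<And>t. (\<Sum>k\<le>n. const3 (t ^ k) * a k) \<in> W"
  shows "k \<le> n \<Longrightarrow> a k \<in> W"
  using assms(2)
proof (induction n arbitrary: a k)
  case 0
  then show ?case using "0.prems"(2)[of 1] by simp
next
  case (Suc n)
  define G where "G t = (\<Sum>k\<le>Suc n. const3 (t ^ k) * a k)" for t
  have GW: "G t \<in> W" for t using Suc.prems(2)[of t] by (simp only: G_def)
  define b where "b k = const3 (2 ^ k - 2 ^ Suc n) * a k" for k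
  have "(\<Sum>k\<le>n. const3 (t ^ k) * b k) = G (2 * t) - const3 (2 ^ Suc n) * G t" for t
  proof -
    have "G (2 * t) - const3 (2 ^ Suc n) * G t
        = (\<Sum>k\<le>Suc n. const3 ((2 * t) ^ k) * a k - const3 (2 ^ Suc n) * (const3 (t ^ k) * a k))"
      by (simp only: G_def sum_distrib_left sum_subtractf)
    also have "\<dots> = (\<Sum>k\<le>Suc n. const3 (t ^ k) * b k)"
    proof (rule sum.cong[OF refl])
      fix k
      have "const3 ((2 * t) ^ k) - const3 (2 ^ Suc n) * const3 (t ^ k)
          = const3 (t ^ k) * const3 (2 ^ k - 2 ^ Suc n)"
        by (simp only: power_mult_distrib flip: const3_mult const3_uminus const3_add diff_conv_add_uminus)
          (simp add: algebra_simps const3_def single_diff)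
      then show "const3 ((2 * t) ^ k) * a k - const3 (2 ^ Suc n) * (const3 (t ^ k) * a k) = const3 (t ^ k) * b k"
        unfolding b_def by (metis (no_types, lifting) left_diff_distrib mult.assoc)
    qed
    also have "\<dots> = (\<Sum>k\<le>n. const3 (t ^ k) * b k)" by (simp add: b_def)
    finally show ?thesis by simp
  qed
  then have "(\<Sum>k\<le>n. const3 (t ^ k) * b k) \<in> W" for t
    using is_ideal_diff[OF W] is_ideal_mult[OF W] GW by metis
  then have bW: "b k \<in> W" if "k \<le> n" for k using Suc.IH[of k b] that by blast
  have le: "a k \<in> W" if "k \<le> n" for k
  proof -
    have "(2::'k) ^ k \<noteq> 2 ^ Suc n"
    proof
      assume "(2::'k) ^ k = 2 ^ Suc n"
      then have "of_nat (2 ^ k) = (of_nat (2 ^ Suc n) :: 'k)" by simp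
      then have "(2::nat) ^ k = 2 ^ Suc n" unfolding of_nat_eq_iff .
      then show False using that by (simp only: power_inject_exp)
    qed
    then have "a k = const3 (inverse (2 ^ k - 2 ^ Suc n)) * b k"
      unfolding b_def by (simp flip: mult.assoc const3_mult)
    then show ?thesis using is_ideal_mult[OF W bW[OF that]] by metis
  qed
  have "a (Suc n) = G 1 - (\<Sum>k\<le>n. a k)"
    by (simp add: G_def)
  also have "\<dots> \<in> W" by (intro is_ideal_diff[OF W] is_ideal_sum[OF W] GW) (use le in auto)
  finally show ?case using le Suc.prems(1) by (metis le_Suc_eq)
qed

lemma curve_coefficients_lookup:
  fixes G :: "'k::field_char_0 \<Rightarrow> 'k poly3"
  assumes W: "is_ideal W" "\<And>t. G t \<in> W" and T: "finite T" "\<And>t m. m \<notin> T \<Longrightarrow> lookup (G t) m = 0"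
    and R: "\<And>t m. m \<in> T \<Longrightarrow> lookup (G t) m = poly (R m) t"
  shows "(\<Sum>m\<in>T. Poly_Mapping.single m (coeff (R m) k)) \<in> W"
proof -
  define a where "a k = (\<Sum>m\<in>T. Poly_Mapping.single m (coeff (R m) k))" for k
  \<comment> \<open>Including k covers coefficients beyond all degrees as well.\<close>
  define n where "n = max k (Max ((\<lambda>m. degree (R m)) ` T))"
  have n: "degree (R m) \<le> n" if "m \<in> T" for m
    unfolding n_def using that T(1) by (simp add: le_max_iff_disj)
  have pn: "poly p t = (\<Sum>k\<le>n. t ^ k * coeff p k)" if "degree p \<le> n" for p :: "'k poly" and t
  proof -
    have "poly p t = (\<Sum>k\<le>degree p. coeff p k * t ^ k)" by (rule poly_altdef)
    also have "\<dots> = (\<Sum>k\<le>n. coeff p k * t ^ k)"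
      by (rule sum.mono_neutral_left) (use that in \<open>auto simp: coeff_eq_0\<close>)
    finally show ?thesis by (simp add: mult.commute)
  qed
  have "G t = (\<Sum>k\<le>n. const3 (t ^ k) * a k)" for t
  proof (rule poly_mapping_eqI)
    fix m
    have look: "lookup (a k) m = (if m \<in> T then coeff (R m) k else 0)" for k
    proof -
      have "lookup (a k) m = (\<Sum>m'\<in>T. if m' = m then coeff (R m) k else 0)"
        unfolding a_def lookup_sum by (rule sum.cong) (auto simp: lookup_single when_def)
      then show ?thesis using T(1) by simp
    qed
    show "lookup (G t) m = lookup (\<Sum>k\<le>n. const3 (t ^ k) * a k) m"
      using T(2)[of m t] R[of m t] n[of m] by (cases "m \<in> T") (simp_all add: lookup_sum look pn)
  qed
  then have "(\<Sum>k\<le>n. const3 (t ^ k) * a k) \<in> W" for t using W(2) by metis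
  then show ?thesis
    using curve_coefficients[OF W(1), where n = n and a = a and k = k] by (simp add: a_def n_def)
qed

subsection \<open>Borel-fixedness\<close>

definition elem_mat :: "nat \<Rightarrow> 'k::comm_ring_1 \<Rightarrow> nat \<Rightarrow> nat \<Rightarrow> 'k" where
  "elem_mat i s a b = (if a = b then 1 else if a = i \<and> b = 2 then s else 0)"

text \<open>Trades k factors \<open>Xv 2\<close> for k factors \<open>Xv i\<close>, for i < 2 and k
  at most the exponent of \<open>Xv 2\<close>. These are the monomials in the binomial expansion
  after \<open>Xv 2\<close> is replaced by s \<open>Xv i\<close> + \<open>Xv 2\<close>.\<close>

definition shift_mon :: "nat \<Rightarrow> mon3 \<Rightarrow> nat \<Rightarrow> mon3" where
  "shift_mon i v k = (expo v 0 + (if i = 0 then k else 0), expo v 1 + (if i = 0 then 0 else k), expo v 2 - k)"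

lemma linear_form_cong: "(\<And>i. i < 3 \<Longrightarrow> g i j = h i j) \<Longrightarrow> linear_form g j = linear_form h j"
  by (simp add: linear_form_def)

lemma linear_form_elem_mat:
  assumes "i < 2"
  shows "linear_form (elem_mat i s) 0 = Xv 0" "linear_form (elem_mat i s) 1 = Xv 1"
    "linear_form (elem_mat i s) 2 = const3 s * Xv i + Xv 2"
  using assms less_2_cases[of i]
  by (auto simp: linear_form_def elem_mat_def sum_less_3)

lemma subst3_elem_mat_inverse:
  assumes "i < 2"
  shows "subst3 (linear_form (elem_mat i (- s))) (subst3 (linear_form (elem_mat i s)) p) = p"
  unfolding subst3_subst3
proof (rule subst3_id)
  fix j :: nat assume "j < 3"
  then have "j = 0 \<or> j = 1 \<or> j = 2" by auto
  then show "subst3 (linear_form (elem_mat i (- s))) (linear_form (elem_mat i s) j) = Xv j"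
    using assms less_2_cases[of i]
    by (auto simp: linear_form_elem_mat[simplified] subst3_Xv subst3_add subst3_mult const3_uminus)
qed

lemma subst3_elem_mat_single:
  assumes "i < 2"
  shows "subst3 (linear_form (elem_mat i s)) (Poly_Mapping.single v c)
    = (\<Sum>k\<le>expo v 2. Poly_Mapping.single (shift_mon i v k) (c * (s ^ k * of_nat (expo v 2 choose k))))"
proof -
  let ?X = "\<lambda>k. (const3 s * Xv i) ^ k * Xv 2 ^ (expo v 2 - k) :: 'a poly3"
  have of_nat: "of_nat n = (const3 (of_nat n) :: 'a poly3)" for n by (simp add: const3_def)
  have "subst3 (linear_form (elem_mat i s)) (Poly_Mapping.single v c)
      = const3 c * (Xv 0 ^ expo v 0 * Xv 1 ^ expo v 1
        * (\<Sum>k\<le>expo v 2. of_nat (expo v 2 choose k) * (const3 s * Xv i) ^ k * Xv 2 ^ (expo v 2 - k)))"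
    by (simp only: subst3_single linear_form_elem_mat[OF assms] binomial_ring)
  also have "\<dots> = (\<Sum>k\<le>expo v 2. const3 (c * (s ^ k * of_nat (expo v 2 choose k))) *
      (Xv 0 ^ expo v 0 * Xv 1 ^ expo v 1 * (Xv i ^ k * Xv 2 ^ (expo v 2 - k))))"
    unfolding sum_distrib_left
    by (rule sum.cong) (simp_all add: of_nat const3_mult const3_power power_mult_distrib ac_simps)
  also have "\<dots> = (\<Sum>k\<le>expo v 2. Poly_Mapping.single (shift_mon i v k) (c * (s ^ k * of_nat (expo v 2 choose k))))"
    unfolding single_eq_powers
    by (rule sum.cong)
      (use assms less_2_cases[of i] in \<open>auto simp: shift_mon_def power_add ac_simps\<close>)
  finally show ?thesis .
qed

lemma shift_mon_0: "shift_mon i v 0 = v"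
  by (cases v) (simp add: shift_mon_def)

lemma shift_mon_1:
  assumes "i < 2" "expo v 2 \<noteq> 0" "shift_mon i v 1 = var_exp i + n"
  shows "v = var_exp 2 + n"
  using assms less_2_cases[of i]
  by (cases v; cases n) (auto simp: shift_mon_def var_exp_def)

lemma shift_mon_var: "i < 2 \<Longrightarrow> shift_mon i (var_exp 2 + m) 1 = var_exp i + m"
  using less_2_cases[of i] by (cases m) (auto simp: shift_mon_def var_exp_def)

lemma shift_mon_1_ex: "i < 2 \<Longrightarrow> expo v 2 \<noteq> 0 \<Longrightarrow> \<exists>n. shift_mon i v 1 = var_exp i + n"
  using less_2_cases[of i]
  by (cases v) (auto simp: shift_mon_def var_exp_def)

lemma revlex_var_exp: "i < 2 \<Longrightarrow> revlex_less (var_exp 2 + m) (var_exp i + m)"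
  using less_2_cases[of i] by (auto simp: revlex_less_def var_exp_def expo_def tdeg_def)

text \<open>From here on the variables are numbered from 0, as in Xv. Pull the echelon vector with pivot
  x_2 m back along the one-parameter family x_2 \<mapsto> x_2 + t x_i. The result lies in g I for every t,
  hence so does its t-derivative at t = 0; the latter has leading monomial x_i m, with coefficient a
  nonzero multiple of the exponent of x_2 (characteristic 0).\<close>

lemma full_echelon_borel:
  fixes I :: "'k::field_char_0 poly3 set"
  assumes I: "homogeneous_ideal I" and ech: "full_echelon I e P D F"
    and g: "D g \<noteq> 0" "det3 g \<noteq> 0" and i: "i < 2" and w: "var_exp 2 + m \<in> P"
  shows "var_exp i + m \<in> lead_set (act g I)"
proof -
  note I' = homogeneous_ideal_is_ideal[OF homogeneous_ideal_act[OF I g(2)]]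
  define w where "w = var_exp 2 + m"
  have e: "echelon I e P D F" using ech by (simp add: full_echelon_def)
  have wP: "w \<in> P" using w by (simp add: w_def)
  have Fact: "\<And>g. F w g \<in> act g I" and Fhom: "\<And>g. homog e (F w g)"
    and Fpf: "\<And>m. poly_fun (\<lambda>g. lookup (F w g) m)"
    and Fab: "\<And>g m. revlex_less w m \<Longrightarrow> lookup (F w g) m = 0"
    and Fpiv: "\<And>g. lookup (F w g) w = D g"
    using e wP unfolding echelon_def by auto
  \<comment> \<open>The product of \<open>elem_mat i t\<close> and g: t times row 2 is added to row
    i. The entries are affine in t, so polynomial functions of \<open>h t\<close> are polynomials in
    t.\<close>
  define h where "h t = (\<lambda>a b. g a b + t * (if a = i then g 2 b else 0))" for t
  have h: "subst3 (linear_form (h t)) p = subst3 (linear_form (elem_mat i t)) (subst3 (linear_form g) p)" for t p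
    unfolding subst3_mat_mult3
  proof (rule subst3_cong, rule linear_form_cong)
    fix a b :: nat assume "a < 3"
    then have "a = 0 \<or> a = 1 \<or> a = 2" by auto
    then show "h t a b = mat_mult3 (elem_mat i t) g a b"
      using less_2_cases[OF i] by (auto simp: h_def mat_mult3_def elem_mat_def sum_less_3)
  qed
  define G where "G t = subst3 (linear_form (elem_mat i (- t))) (F w (h t))" for t
  have GI: "G t \<in> act g I" for t
  proof -
    obtain q where "q \<in> I" "F w (h t) = subst3 (linear_form (h t)) q"
      using Fact[of "h t"] by (auto simp: act_eq)
    then show ?thesis
      using subst3_elem_mat_inverse[OF i] by (auto simp: G_def h act_eq)
  qed
  have "\<forall>v. \<exists>q. \<forall>t. lookup (F w (h t)) v = poly q t"
    unfolding h_def
    using poly_fun_line[OF Fpf, where A = g and B = "\<lambda>a b. if a = i then g 2 b else 0"] by blast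
  then obtain q where q: "\<And>v t. lookup (F w (h t)) v = poly (q v) t" by metis
  define T where "T = {m. tdeg m = e}"
  have T: "finite T" by (simp add: T_def finite_tdeg)
  \<comment> \<open>The coefficient of m' in the image of the monomial v under x_2 \<mapsto> x_2 - t
    x_i, as a polynomial in t.\<close>
  define S where "S v m' = (\<Sum>k\<le>expo v 2. Polynomial.monom
      (if shift_mon i v k = m' then (- 1) ^ k * of_nat (expo v 2 choose k) else 0) k :: 'k poly)" for v m'
  define R where "R m' = (\<Sum>v\<in>T. q v * S v m')" for m'
  have GR: "lookup (G t) m' = poly (R m') t" for t m'
  proof -
    have "F w (h t) = (\<Sum>v\<in>T. Poly_Mapping.single v (poly (q v) t))"
      unfolding q[symmetric] by (rule sum_monomials[OF T]) (use Fhom in \<open>auto simp: T_def homog_def\<close>)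
    then have "lookup (G t) m' = (\<Sum>v\<in>T. \<Sum>k\<le>expo v 2. if shift_mon i v k = m'
        then poly (q v) t * ((- t) ^ k * of_nat (expo v 2 choose k)) else 0)"
      by (simp add: G_def subst3_sum subst3_elem_mat_single[OF i] lookup_sum lookup_single when_def)
    also have "\<dots> = poly (R m') t"
      unfolding R_def S_def poly_sum poly_mult sum_distrib_left
      by (intro sum.cong refl) (auto simp: poly_monom power_minus[of t] ac_simps)
    finally show ?thesis .
  qed
  have Ghom: "homog e (G t)" for t unfolding G_def by (rule homog_subst3[OF Fhom])
  define G1 where "G1 = (\<Sum>m'\<in>T. Poly_Mapping.single m' (coeff (R m') 1))"
  have G1I: "G1 \<in> act g I"
    unfolding G1_def
  proof (rule curve_coefficients_lookup[where G = G])
    show "lookup (G t) m' = 0" if "m' \<notin> T" for t m'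
      using Ghom[of t] that unfolding T_def homog_lookup by blast
  qed (rule I' GI T GR)+
  have coeffS: "coeff (S v m') k = (if k \<le> expo v 2 \<and> shift_mon i v k = m'
      then (- 1) ^ k * of_nat (expo v 2 choose k) else 0)" for v m' k
    unfolding S_def coeff_sum coeff_monom by (subst sum.delta) auto
  have q0: "q v = 0" if "revlex_less w v" for v
  proof -
    have "\<forall>t. poly (q v) t = 0" using Fab[OF that] by (simp flip: q)
    then show ?thesis using poly_all_0_iff_0 by blast
  qed
  have coeffR: "coeff (R m') 1 = (\<Sum>v\<in>T. coeff (q v) 0 * coeff (S v m') 1 + coeff (q v) 1 * coeff (S v m') 0)" for m'
    by (simp add: R_def coeff_sum coeff_mult)
  \<comment> \<open>The coefficient of t has two sources. With k = 0 the monomial is v = m', which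
    lies above w, so \<open>q v\<close> = 0. With k = 1 one has v = x_2 n and m' = x_i n; if n
    differs from m, then v again lies above w. Only v = w remains, and its sign comes from
    -t.\<close>
  have contrib: "coeff (q v) 0 * coeff (S v m') 1 + coeff (q v) 1 * coeff (S v m') 0
      = (if v = w \<and> m' = var_exp i + m then - D g * of_nat (expo w 2) else 0)"
    if m': "m' = var_exp i + m \<or> revlex_less (var_exp i + m) m'" for v m'
  proof -
    have gt: "revlex_less w m'"
      using m' revlex_var_exp[OF i, of m] revlex_trans unfolding w_def by metis
    have "coeff (q v) 1 * coeff (S v m') 0 = 0"
      using q0[OF gt] by (auto simp: coeffS shift_mon_0)
    moreover have "coeff (q v) 0 * coeff (S v m') 1
      = (if v = w \<and> m' = var_exp i + m then - D g * of_nat (expo w 2) else 0)"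
    proof (cases "1 \<le> expo v 2 \<and> shift_mon i v 1 = m'")
      case True
      then obtain n where n: "m' = var_exp i + n" using shift_mon_1_ex[OF i, of v] by auto
      then have v: "v = var_exp 2 + n" using shift_mon_1[OF i, of v n] True by auto
      show ?thesis
      proof (cases "n = m")
        case True': True
        then have "coeff (q v) 0 = D g"
          using q[of 0 w] Fpiv[of "h 0"] v by (simp add: w_def h_def poly_0_coeff_0)
        then show ?thesis using True True' v n by (simp add: coeffS w_def)
      next
        case False
        then have "revlex_less m n" using m' n by simp
        then show ?thesis using q0[of v] v n False by (simp add: w_def)
      qed
    next
      case False
      then have "\<not> (v = w \<and> m' = var_exp i + m)"
        using shift_mon_var[OF i, of m] by (auto simp: w_def expo_add expo_var_exp)
      then show ?thesis using False by (auto simp: coeffS)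
    qed
    ultimately show ?thesis by simp
  qed
  have wT: "w \<in> T" using e wP by (auto simp: echelon_def T_def)
  then have iT: "var_exp i + m \<in> T" by (simp add: T_def w_def)
  have lookG1: "lookup G1 m' = (if m' \<in> T then coeff (R m') 1 else 0)" for m'
  proof -
    have "lookup G1 m' = (\<Sum>v\<in>T. if v = m' then coeff (R m') 1 else 0)"
      unfolding G1_def lookup_sum by (rule sum.cong) (auto simp: lookup_single when_def)
    then show ?thesis using T by simp
  qed
  have "coeff (R (var_exp i + m)) 1 = - D g * of_nat (expo w 2)"
    unfolding coeffR using contrib[of "var_exp i + m"] T wT by simp
  moreover have "expo w 2 \<noteq> 0" by (simp add: w_def expo_add expo_var_exp)
  ultimately have nz: "lookup G1 (var_exp i + m) \<noteq> 0"
    using g(1) iT by (simp add: lookG1)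
  have "lead_mon G1 = var_exp i + m"
  proof (rule lead_mon_eqI[OF nz])
    fix m' assume m': "revlex_less (var_exp i + m) m'"
    then have ne: "m' \<noteq> var_exp i + m" using revlex_irrefl by metis
    have "coeff (R m') 1 = 0"
      unfolding coeffR using contrib[OF disjI2[OF m']] ne by (intro sum.neutral ballI) simp
    then show "lookup G1 m' = 0" by (simp add: lookG1)
  qed
  moreover have "G1 \<noteq> 0" using nz by auto
  ultimately show ?thesis using G1I by (force simp: lead_set_def)
qed

text \<open>The open set is cut out by the product of the pivot values in degrees at most N. Since A
  vanishes from degree N on, every monomial of degree at least N is leading, so these finitely many
  conditions control in(g I) and the exchange property in all degrees.\<close>

theorem generic_coordinates:
  fixes I :: "'k::field_char_0 poly3 set"
  assumes I: "homogeneous_ideal I" and art: "artinian I"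
  obtains g where "det3 g \<noteq> 0" "gin I = initial_ideal (act g I)"
    "\<And>(i::nat) m. i < 2 \<Longrightarrow> var_exp 2 + m \<in> lead_set (act g I) \<Longrightarrow> var_exp i + m \<in> lead_set (act g I)"
proof -
  note I0 = homogeneous_ideal_is_ideal[OF I]
  obtain N where N: "\<And>d. d \<ge> N \<Longrightarrow> \<not> A_nonzero_in I d" using art by (auto simp: artinian_def)
  obtain P D F where ech: "\<And>e. full_echelon I e (P e) (D e) (F e)"
    using full_echelon_exists[OF I0] by metis
  \<comment> \<open>All multiples of pivots of degree at most N. A leading monomial of larger degree
    is a multiple of one of degree exactly N, and those are all pivots.\<close>
  define M where "M = {m. \<exists>e\<le>N. \<exists>w\<in>P e. mon_dvd w m}"
  define f where "f g = (\<Prod>e\<le>N. D e g)" for g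
  have Dpf: "poly_fun (D e)" "\<exists>g. D e g \<noteq> 0" for e
    using ech[of e] by (auto simp: full_echelon_def echelon_def)
  have "poly_fun (\<lambda>g. \<Prod>e\<le>N. D e g)" by (intro poly_fun_prod Dpf)
  then have fpf: "poly_fun f" unfolding f_def[abs_def] .
  have fnz: "\<exists>g. f g \<noteq> 0"
    using poly_fun_nonzero_prod[of "{..N}" D] Dpf by (auto simp: f_def)
  have high: "m \<in> lead_set (act g I)" if "det3 g \<noteq> 0" "N \<le> tdeg m" for g m
  proof -
    have "\<not> A_nonzero_in (act g I) (tdeg m)" using N that A_nonzero_in_act by blast
    then have "Poly_Mapping.single m 1 \<in> act g I"
      using homog_single[of m 1] unfolding A_nonzero_in_def by blast
    moreover have "lead_mon (Poly_Mapping.single m (1::'k)) = m"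
      by (rule lead_mon_eqI) (auto simp: lookup_single when_def revlex_irrefl)
    moreover have "Poly_Mapping.single m (1::'k) \<noteq> 0"
      using lookup_single_eq[of m "1::'k"] by (metis lookup_zero one_neq_zero)
    ultimately show ?thesis by (force simp: lead_set_def)
  qed
  have lead: "m \<in> lead_set (act g I) \<longleftrightarrow> m \<in> P (tdeg m)"
    if "det3 g \<noteq> 0" "f g \<noteq> 0" "tdeg m \<le> N" for g m
    by (rule full_echelon_lead[OF I ech]) (use that in \<open>auto simp: f_def\<close>)
  have leadM: "lead_set (act g I) = M" if g: "det3 g \<noteq> 0" "f g \<noteq> 0" for g
  proof (intro set_eqI iffI)
    fix m assume m: "m \<in> lead_set (act g I)"
    show "m \<in> M"
    proof (cases "tdeg m \<le> N")
      case True
      then have "m \<in> P (tdeg m)" using lead g m by blast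
      then show ?thesis using True by (force simp: M_def mon_dvd_def)
    next
      case False
      have "\<exists>n m'. m = n + m' \<and> tdeg m' = N"
      proof -
        obtain a b c where abc: "m = (a, b, c)" by (cases m)
        define a' where "a' = min a N"
        define b' where "b' = min b (N - a')"
        define c' where "c' = N - a' - b'"
        have "a' \<le> a" "b' \<le> b" "c' \<le> c" "a' + b' + c' = N"
          using False by (auto simp: a'_def b'_def c'_def abc tdeg_def)
        then have "m = (a - a', b - b', c - c') + (a', b', c') \<and> tdeg (a', b', c') = N"
          by (simp add: abc tdeg_def)
        then show ?thesis by blast
      qed
      then obtain n m' where m': "m = n + m'" "tdeg m' = N" by blast
      then have "m' \<in> P N" using high[OF g(1), of m'] lead[OF g, of m'] by simp
      then show ?thesis using m' unfolding M_def mon_dvd_iff by blast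
    qed
  next
    note I' = homogeneous_ideal_is_ideal[OF homogeneous_ideal_act[OF I g(1)]]
    fix m assume "m \<in> M"
    then obtain e w n where w: "e \<le> N" "w \<in> P e" "m = n + w"
      unfolding M_def mon_dvd_iff by blast
    then have "tdeg w = e" using ech[of e] by (auto simp: full_echelon_def echelon_def)
    then have "w \<in> lead_set (act g I)" using lead[OF g, of w] w by simp
    then show "m \<in> lead_set (act g I)" using lead_set_add[OF I'] w(3) by blast
  qed
  define J where "J = {q :: 'k poly3. Poly_Mapping.keys q \<subseteq> M}"
  have init: "initial_ideal (act g I) = J" if "det3 g \<noteq> 0" "f g \<noteq> 0" for g
    using initial_ideal_eq[OF homogeneous_ideal_is_ideal[OF homogeneous_ideal_act[OF I that(1)]]]
      leadM[OF that] by (simp add: J_def)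
  obtain p where p: "matrix_poly p" "\<And>g. eval9 p g = f g" using poly_fun_eval9[OF fpf] by blast
  have p0: "p \<noteq> 0" using fnz p(2) by (auto simp: eval9_eq)
  \<comment> \<open>Any competing open set in the definition of \<open>gin\<close> meets the present
    one at an invertible g, which forces the two ideals to agree.\<close>
  have common: "\<exists>g. det3 g \<noteq> 0 \<and> f g \<noteq> 0 \<and> eval9 r g \<noteq> 0" if r: "matrix_poly r" "r \<noteq> 0" for r
  proof -
    obtain g1 where "det3 g1 \<noteq> (0::'k)" using det3_nonzero_exists by blast
    moreover obtain g2 where "f g2 \<noteq> 0" using fnz by blast
    ultimately obtain g3 where "det3 g3 \<noteq> 0" "f g3 \<noteq> 0"
      using poly_fun_nonzero_mult[OF poly_fun_det3 fpf] by metis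
    moreover obtain g4 where "eval9 r g4 \<noteq> 0" using eval9_nonzero[OF r] by blast
    ultimately obtain g where "det3 g * f g \<noteq> 0" "eval9 r g \<noteq> 0"
      using poly_fun_nonzero_mult[OF poly_fun_mult[OF poly_fun_det3 fpf] eval9_poly_fun[OF r(1)], of g3 g4]
      by auto
    then show ?thesis by auto
  qed
  have gin: "gin I = J"
    unfolding gin_def
  proof (rule the_equality)
    show "\<exists>f. matrix_poly f \<and> f \<noteq> 0 \<and> (\<forall>g. det3 g \<noteq> 0 \<and> eval9 f g \<noteq> 0 \<longrightarrow> initial_ideal (act g I) = J)"
      using p p0 init by (intro exI[of _ p]) auto
  next
    fix J'
    assume "\<exists>f. matrix_poly f \<and> f \<noteq> 0 \<and> (\<forall>g. det3 g \<noteq> 0 \<and> eval9 f g \<noteq> 0 \<longrightarrow> initial_ideal (act g I) = J')"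
    then obtain r where r: "matrix_poly r" "r \<noteq> 0"
      "\<And>g. det3 g \<noteq> 0 \<Longrightarrow> eval9 r g \<noteq> 0 \<Longrightarrow> initial_ideal (act g I) = J'" by blast
    then show "J' = J" using common[OF r(1,2)] init by metis
  qed
  obtain g where g: "det3 g \<noteq> 0" "f g \<noteq> 0" using common[OF p(1) p0] by blast
  show ?thesis
  proof
    show "det3 g \<noteq> 0" by (rule g)
    show "gin I = initial_ideal (act g I)" using gin init[OF g] by simp
    fix i :: nat and m assume i: "i < 2" and m: "var_exp 2 + m \<in> lead_set (act g I)"
    show "var_exp i + m \<in> lead_set (act g I)"
    proof (cases "tdeg (var_exp 2 + m) \<le> N")
      case True
      then have "D (tdeg (var_exp 2 + m)) g \<noteq> 0" using g(2) by (auto simp: f_def)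
      then show ?thesis
        using full_echelon_borel[OF I ech _ g(1) i] lead[OF g True] m by blast
    next
      case False
      then show ?thesis using high[OF g(1), of "var_exp i + m"] by simp
    qed
  qed
qed

section \<open>Betti numbers of monomial ideals\<close>

context vector_space
begin

lemma span_image_finite:
  assumes "finite A" "y \<in> span (f ` A)"
  shows "\<exists>a. y = (\<Sum>x\<in>A. scale (a x) (f x))"
  using assms
proof (induction A arbitrary: y rule: finite_induct)
  case (insert x A)
  then obtain k where "y - scale k (f x) \<in> span (f ` A)"
    by (auto simp: span_breakdown_eq)
  then obtain a where a: "y - scale k (f x) = (\<Sum>x\<in>A. scale (a x) (f x))"
    using insert.IH by blast
  have "(\<Sum>z\<in>A. scale ((a(x := k)) z) (f z)) = (\<Sum>z\<in>A. scale (a z) (f z))"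
    by (rule sum.cong) (use insert.hyps in auto)
  then have "y = (\<Sum>z\<in>insert x A. scale ((a(x := k)) z) (f z))"
    using insert.hyps a by (simp add: algebra_simps)
  then show ?case by blast
qed simp

text \<open>A family independent modulo \<open>span C\<close>, without passing to a quotient space.
  The cardinality claim also records that \<open>f\<close> is injective on \<open>A\<close> and
  avoids \<open>C\<close>, which is what turns the family into a lower bound for a difference of
  dimensions.\<close>

lemma independent_relative:
  assumes "independent C" "finite C" "finite A"
    and "\<And>a. (\<Sum>x\<in>A. scale (a x) (f x)) \<in> span C \<Longrightarrow> \<forall>x\<in>A. a x = 0"
  shows "independent (C \<union> f ` A) \<and> card (C \<union> f ` A) = card C + card A"
  using assms(3,4)
proof (induction A rule: finite_induct)
  case (insert x A)
  have IH: "independent (C \<union> f ` A) \<and> card (C \<union> f ` A) = card C + card A"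
  proof (rule insert.IH)
    fix a assume a: "(\<Sum>x\<in>A. scale (a x) (f x)) \<in> span C"
    have "(\<Sum>z\<in>A. scale ((a(x := 0)) z) (f z)) = (\<Sum>z\<in>A. scale (a z) (f z))"
      by (rule sum.cong) (use insert.hyps in auto)
    then have "(\<Sum>z\<in>insert x A. scale ((a(x := 0)) z) (f z)) \<in> span C"
      using a insert.hyps by simp
    then have "\<forall>z\<in>insert x A. (a(x := 0)) z = 0" by (rule insert.prems)
    then show "\<forall>x\<in>A. a x = 0" using insert.hyps(2) by (metis fun_upd_other insertCI)
  qed
  have x: "f x \<notin> span (C \<union> f ` A)"
  proof
    assume "f x \<in> span (C \<union> f ` A)"
    then obtain y z where yz: "f x = y + z" "y \<in> span C" "z \<in> span (f ` A)"
      unfolding span_Un by blast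
    obtain a where a: "z = (\<Sum>x\<in>A. scale (a x) (f x))"
      using span_image_finite[OF insert.hyps(1) yz(3)] by blast
    have "(\<Sum>z\<in>A. scale ((a(x := - 1)) z) (f z)) = z"
      unfolding a by (rule sum.cong) (use insert.hyps in auto)
    then have "(\<Sum>z\<in>insert x A. scale ((a(x := - 1)) z) (f z)) = - y"
      using insert.hyps yz(1) by simp
    then have "(\<Sum>z\<in>insert x A. scale ((a(x := - 1)) z) (f z)) \<in> span C"
      using span_neg[OF yz(2)] by simp
    then have "(a(x := - 1)) x = 0" using insert.prems by blast
    then show False by simp
  qed
  have fin: "finite (C \<union> f ` A)" using assms(2) insert.hyps by simp
  have "f x \<notin> C \<union> f ` A" using x span_superset[of "C \<union> f ` A"] by (metis subsetD)
  moreover have "independent (insert (f x) (C \<union> f ` A))"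
    using independent_insertI[OF x] IH by blast
  ultimately show ?case using IH fin insert.hyps by simp
qed (use assms in simp)

text \<open>\<open>dim\<close> is the cardinality of a basis, hence 0 in infinite dimension; the
  finite set \<open>W\<close> rules that case out.\<close>

lemma independent_card_le_dim_span:
  assumes "independent B" "B \<subseteq> V" "V \<subseteq> span W" "finite W"
  shows "card B \<le> dim V"
proof -
  obtain C where C: "C \<subseteq> V" "independent C" "V \<subseteq> span C" "card C = dim V"
    using basis_exists by blast
  have "finite C" using independent_span_bound[OF assms(4) C(2)] C(1) assms(3) by blast
  then show ?thesis
    using independent_span_bound[OF _ assms(1), of C] assms(2) C by auto
qed

lemma finite_basis_exists:
  assumes "V \<subseteq> span W" "finite W"
  obtains C where "finite C" "C \<subseteq> V" "independent C" "V \<subseteq> span C" "card C = dim V"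
proof -
  obtain C where C: "C \<subseteq> V" "independent C" "V \<subseteq> span C" "card C = dim V"
    using basis_exists by blast
  have "finite C" using independent_span_bound[OF assms(2) C(2)] C(1) assms(1) by blast
  then show ?thesis using that C by blast
qed

end

section \<open>The Koszul complex in three variables\<close>

lemma vector_space_kscale: "vector_space (kscale :: 'k::field \<Rightarrow> (nat set \<Rightarrow> 'k poly3) \<Rightarrow> _)"
  by unfold_locales
    (auto simp: kscale_def fun_eq_iff distrib_left distrib_right const3_add const3_mult mult.assoc)

interpretation K: vector_space "kscale :: 'k::field \<Rightarrow> (nat set \<Rightarrow> 'k poly3) \<Rightarrow> _"
  by (rule vector_space_kscale)

lemma sum_apply: "(\<Sum>x\<in>A. f x) S = (\<Sum>x\<in>A. f x S)"
  by (induction A rule: infinite_finite_induct) simp_all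

lemma kdiff_add: "kdiff (c + c') = kdiff c + kdiff c'"
  by (rule ext) (simp add: kdiff_def distrib_left sum.distrib)

lemma kdiff_kscale: "kdiff (kscale a c) = kscale a (kdiff c)"
  by (rule ext) (simp add: kdiff_def kscale_def sum_distrib_left ac_simps)

lemma linear_kdiff: "Vector_Spaces.linear kscale kscale (kdiff :: (nat set \<Rightarrow> 'k::field poly3) \<Rightarrow> _)"
  by (simp add: Vector_Spaces.linear_iff vector_space_kscale kdiff_add kdiff_kscale)

lemma subset_less_3:
  assumes "S \<subseteq> {..<3::nat}"
  shows "S \<in> {{}, {0}, {1}, {2}, {0,1}, {0,2}, {1,2}, {0,1,2}}"
proof -
  have "{..<3::nat} = {0, 1, 2}" by auto
  then have "S \<in> Pow {0, 1, 2}" using assms by simp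
  then show ?thesis by (auto simp: Pow_insert)
qed

lemma kdiff_empty: "kdiff c {} = Xv 0 * c {0} + Xv 1 * c {1} + Xv 2 * c {2}"
  by (simp add: kdiff_def sum_less_3)

lemma kdiff_singleton:
  "kdiff c {0} = - (Xv 1 * c {0,1}) - Xv 2 * c {0,2}"
  "kdiff c {1} = Xv 0 * c {0,1} - Xv 2 * c {1,2}"
  "kdiff c {2} = Xv 0 * c {0,2} + Xv 1 * c {1,2}"
proof -
  have s: "{..<3} - {0} = {1, 2::nat}" "{..<3} - {1} = {0, 2::nat}" "{..<3} - {2} = {0, 1::nat}"
    by auto
  have c: "{u \<in> {0}. u < 1} = {0::nat}" "{u \<in> {0}. u < 2} = {0::nat}" "{u \<in> {1}. u < 0} = ({} :: nat set)"
    "{u \<in> {1}. u < 2} = {1::nat}" "{u \<in> {2}. u < 0} = ({} :: nat set)" "{u \<in> {2}. u < 1} = ({} :: nat set)"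
    by auto
  have d: "sum f {a, b} = f a + f b" if "a \<noteq> b" for f :: "nat \<Rightarrow> 'a poly3" and a b
    using that by simp
  show "kdiff c {0} = - (Xv 1 * c {0,1}) - Xv 2 * c {0,2}"
    unfolding kdiff_def s by (subst d, simp, unfold c) (simp add: insert_commute)
  show "kdiff c {1} = Xv 0 * c {0,1} - Xv 2 * c {1,2}"
    unfolding kdiff_def s by (subst d, simp, unfold c) (simp add: insert_commute)
  show "kdiff c {2} = Xv 0 * c {0,2} + Xv 1 * c {1,2}"
    unfolding kdiff_def s by (subst d, simp, unfold c) (simp add: insert_commute)
qed

lemma kdiff_pair:
  "kdiff c {0,1} = Xv 2 * c {0,1,2}" "kdiff c {0,2} = - (Xv 1 * c {0,1,2})" "kdiff c {1,2} = Xv 0 * c {0,1,2}"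
proof -
  have s: "{..<3} - {0, 1} = {2::nat}" "{..<3} - {0, 2} = {1::nat}" "{..<3} - {1, 2} = {0::nat}"
    by auto
  have c: "{u \<in> {0, 1}. u < 2} = {0, 1::nat}" "{u \<in> {0, 2}. u < 1} = {0::nat}" "{u \<in> {1, 2}. u < 0} = ({} :: nat set)"
    by auto
  show "kdiff c {0,1} = Xv 2 * c {0,1,2}" "kdiff c {0,2} = - (Xv 1 * c {0,1,2})" "kdiff c {1,2} = Xv 0 * c {0,1,2}"
    unfolding kdiff_def s using c
    by (simp_all add: insert_commute)
qed

lemma kchains_zero: "c \<in> kchains J i j \<Longrightarrow> \<not> (S \<subseteq> {..<3} \<and> card S = i) \<Longrightarrow> c S = 0"
  unfolding kchains_def by (auto split: if_splits)

lemma kchainsD: "c \<in> kchains J i j \<Longrightarrow> S \<subseteq> {..<3} \<Longrightarrow> card S = i \<Longrightarrow> i \<le> j \<Longrightarrow> c S \<in> J \<and> homog (j - i) (c S)"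
  unfolding kchains_def by (auto split: if_splits)

lemma kdiff_zero:
  assumes "c \<in> kchains J (Suc i) j" "\<not> (T \<subseteq> {..<3} \<and> card T = i)"
  shows "kdiff c T = 0"
  unfolding kdiff_def
proof (rule sum.neutral, rule ballI)
  fix t assume t: "t \<in> {..<3} - T"
  have "\<not> (insert t T \<subseteq> {..<3} \<and> card (insert t T) = Suc i)"
  proof
    assume *: "insert t T \<subseteq> {..<3} \<and> card (insert t T) = Suc i"
    then have "finite T" using finite_subset[of T "{..<3}"] by auto
    then show False using * t assms(2) by auto
  qed
  then show "(- 1) ^ card {u \<in> T. u < t} * Xv t * c (insert t T) = 0"
    using kchains_zero[OF assms(1)] by simp
qed

text \<open>The basis vector x^m e_T of the Koszul complex.\<close>

definition monomial_chain :: "nat set \<Rightarrow> mon3 \<Rightarrow> nat set \<Rightarrow> 'k::field poly3" where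
  "monomial_chain T m = (\<lambda>S. if S = T then Poly_Mapping.single m 1 else 0)"

text \<open>Makes every chain space finite-dimensional, so that the dimensions in
  \<open>betti\<close> can be compared by counting.\<close>

lemma kchains_subset_span:
  "kchains J i j \<subseteq> K.span ((\<lambda>(T, m). monomial_chain T m) ` (Pow {..<3} \<times> {m. tdeg m = j - i}))"
    (is "_ \<subseteq> K.span ?W")
proof
  fix c :: "nat set \<Rightarrow> 'a poly3" assume c: "c \<in> kchains J i j"
  let ?A = "Pow {..<3::nat}" and ?D = "{m. tdeg m = j - i}"
  have "c = (\<Sum>T\<in>?A. \<Sum>m\<in>?D. kscale (lookup (c T) m) (monomial_chain T m))"
  proof (rule ext)
    fix S
    have "(\<Sum>T\<in>?A. \<Sum>m\<in>?D. kscale (lookup (c T) m) (monomial_chain T m)) S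
      = (\<Sum>T\<in>?A. if T = S then (\<Sum>m\<in>?D. Poly_Mapping.single m (lookup (c S) m)) else 0)"
      unfolding sum_apply
    proof (rule sum.cong[OF refl])
      fix T
      show "(\<Sum>m\<in>?D. kscale (lookup (c T) m) (monomial_chain T m) S)
        = (if T = S then (\<Sum>m\<in>?D. Poly_Mapping.single m (lookup (c S) m)) else 0)"
        by (cases "T = S") (simp_all add: kscale_def monomial_chain_def const3_mult_single)
    qed
    also have "\<dots> = (if S \<subseteq> {..<3} then (\<Sum>m\<in>?D. Poly_Mapping.single m (lookup (c S) m)) else 0)"
      by simp
    also have "\<dots> = c S"
    proof (cases "S \<subseteq> {..<3} \<and> card S = i \<and> i \<le> j")
      case True
      then have "homog (j - i) (c S)" using kchainsD[OF c] by blast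
      then have "c S = (\<Sum>m\<in>?D. Poly_Mapping.single m (lookup (c S) m))"
        by (intro sum_monomials finite_tdeg) (auto simp: homog_def)
      then show ?thesis using True by simp
    next
      case False
      then have "c S = 0" using c unfolding kchains_def by auto
      then show ?thesis by simp
    qed
    finally show "c S = (\<Sum>T\<in>?A. \<Sum>m\<in>?D. kscale (lookup (c T) m) (monomial_chain T m)) S" by simp
  qed
  also have "\<dots> \<in> K.span ?W"
    by (intro K.span_sum K.span_scale K.span_base) force
  finally show "c \<in> K.span ?W" .
qed

lemma finite_monomial_chains: "finite ((\<lambda>(T, m). monomial_chain T m) ` (Pow {..<3} \<times> {m. tdeg m = n}))"
  by (intro finite_imageI finite_cartesian_product finite_tdeg) simp

lemma kdiff_kchains_subset_span:
  obtains W where "finite W" "kdiff ` kchains J i j \<subseteq> K.span W"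
proof -
  let ?W = "(\<lambda>(T, m). monomial_chain T m) ` (Pow {..<3} \<times> {m. tdeg m = j - i}) :: (nat set \<Rightarrow> 'a poly3) set"
  interpret L: Vector_Spaces.linear kscale kscale "kdiff :: (nat set \<Rightarrow> 'a poly3) \<Rightarrow> _"
    by (rule linear_kdiff)
  have "kdiff ` kchains J i j \<subseteq> kdiff ` K.span ?W"
    using kchains_subset_span by (intro image_mono)
  also have "\<dots> = K.span (kdiff ` ?W)" by (rule L.span_image[symmetric])
  finally show ?thesis using that finite_monomial_chains by blast
qed

subsection \<open>Monomial ideals\<close>

definition mono_ideal :: "mon3 set \<Rightarrow> 'k::comm_ring_1 poly3 set" where
  "mono_ideal M = {q. Poly_Mapping.keys q \<subseteq> M}"

lemma mono_ideal_iff: "q \<in> mono_ideal M \<longleftrightarrow> (\<forall>m. lookup q m \<noteq> 0 \<longrightarrow> m \<in> M)"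
  unfolding mono_ideal_def in_keys_iff subset_iff mem_Collect_eq ..

lemma mono_ideal_uminus: "q \<in> mono_ideal M \<Longrightarrow> - q \<in> mono_ideal M"
  by (simp add: mono_ideal_iff)

lemma mono_ideal_add: "p \<in> mono_ideal M \<Longrightarrow> q \<in> mono_ideal M \<Longrightarrow> p + q \<in> mono_ideal M"
  unfolding mono_ideal_iff lookup_add by (metis add_0)

lemma mono_ideal_diff: "p \<in> mono_ideal M \<Longrightarrow> q \<in> mono_ideal M \<Longrightarrow> p - q \<in> mono_ideal M"
  using mono_ideal_add[of p M "- q"] mono_ideal_uminus[of q M] by simp

lemma mono_ideal_Xv_mult:
  assumes "\<And>n m. m \<in> M \<Longrightarrow> n + m \<in> M" "p \<in> mono_ideal M"
  shows "Xv i * p \<in> mono_ideal M"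
  unfolding mono_ideal_iff
proof (intro allI impI)
  fix m assume m: "lookup (Xv i * p) m \<noteq> 0"
  then obtain n where n: "m = var_exp i + n" using lookup_Xv_mult_eq_0 by metis
  then have "lookup p n \<noteq> 0" using m by (simp add: lookup_Xv_mult)
  then show "m \<in> M" using assms n unfolding mono_ideal_iff by blast
qed

text \<open>A 2-cycle of the Koszul complex over R is the boundary of some p e_012; it lies in
  J \<otimes> K_2 iff p is in the socle modulo J.\<close>

lemma betti_2_le:
  assumes M: "\<And>n m. m \<in> M \<Longrightarrow> n + m \<in> M"
    and B: "finite B" "\<And>u. Suc (tdeg u) = d \<Longrightarrow> u \<notin> M \<Longrightarrow> (\<And>i. i < 3 \<Longrightarrow> var_exp i + u \<in> M) \<Longrightarrow> u \<in> B"
  shows "betti (mono_ideal M :: 'k::field poly3 set) 2 (d + 2) \<le> card B"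
proof -
  let ?J = "mono_ideal M :: 'k poly3 set"
  \<comment> \<open>The 3-chain p e_012.\<close>
  define tc :: "'k poly3 \<Rightarrow> nat set \<Rightarrow> 'k poly3" where "tc p = (\<lambda>S. if S = {0,1,2} then p else 0)" for p
  let ?Z = "kchains ?J 2 (d + 2) \<inter> {c. kdiff c = 0}" and ?B = "kdiff ` kchains ?J 3 (d + 2)"
  obtain W where W: "finite W" "?B \<subseteq> K.span W" by (rule kdiff_kchains_subset_span)
  obtain C where C: "finite C" "C \<subseteq> ?B" "K.independent C" "?B \<subseteq> K.span C" "card C = K.dim ?B"
    using K.finite_basis_exists[OF W(2,1)] by metis
  let ?G = "(\<lambda>u. kdiff (tc (Poly_Mapping.single u 1))) ` B"
  have e3: "{..<3::nat} = {0,1,2}" by auto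
  have tcK: "tc p \<in> kchains UNIV 3 (Suc n + 2)" if "homog n p" for p n
  proof -
    have "card {0,1,2::nat} = 3" by simp
    moreover have "S = {0,1,2}" if "S \<subseteq> {0,1,2::nat}" "card S = 3" for S
      using card_subset_eq[of "{0,1,2}" S] that by simp
    ultimately show ?thesis using \<open>homog n p\<close> unfolding kchains_def tc_def e3 by auto
  qed
  have tcJ: "tc p \<in> kchains ?J 3 (Suc n + 2)" if "homog n p" "p \<in> ?J" for p n
    using tcK[OF that(1)] that(2) unfolding kchains_def tc_def
    by (auto simp: mono_ideal_def split: if_splits)
  have "?Z \<subseteq> K.span (C \<union> ?G)"
  proof
    fix c assume c: "c \<in> ?Z"
    then have cK: "c \<in> kchains ?J 2 (d + 2)" and c0: "kdiff c = 0" by auto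
    have k0: "- (Xv 1 * c {0,1}) - Xv 2 * c {0,2} = 0"
      using arg_cong[OF c0, of "\<lambda>f. f {0}"] by (simp add: kdiff_singleton[simplified])
    have k1: "Xv 0 * c {0,1} = Xv 2 * c {1,2}"
      using arg_cong[OF c0, of "\<lambda>f. f {1}"] kdiff_singleton(2)[of c] by simp
    \<comment> \<open>From x_0 c_01 = x_2 c_12 and the coprimality of x_0 and x_2, every monomial of
      c_01 contains x_2.\<close>
    have "\<exists>n. m = var_exp 2 + n" if m: "lookup (c {0,1}) m \<noteq> 0" for m
    proof -
      have "lookup (Xv 2 * c {1,2}) (var_exp 0 + m) \<noteq> 0"
        unfolding k1[symmetric] lookup_Xv_mult by (rule m)
      then obtain n where "var_exp 0 + m = var_exp 2 + n" using lookup_Xv_mult_eq_0 by metis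
      then have "expo (var_exp 0 + m) 2 \<noteq> 0" by (simp add: expo_add expo_var_exp)
      then show ?thesis using var_exp_dvd_iff[of 2 m] by (simp add: expo_add expo_var_exp)
    qed
    then obtain p where p: "c {0,1} = Xv 2 * p" using Xv_factor by metis
    have "Xv 2 * (Xv 0 * p) = Xv 2 * c {1,2}" using k1 p by (simp add: ac_simps)
    then have p12: "c {1,2} = Xv 0 * p" using Xv_mult_cancel by metis
    have "Xv 2 * (- (Xv 1 * p)) = Xv 2 * c {0,2}" using k0 p by (simp add: ac_simps)
    then have p02: "c {0,2} = - (Xv 1 * p)" using Xv_mult_cancel by metis
    have cS: "c S \<in> ?J \<and> homog d (c S)" if "S \<in> {{0,1},{0,2},{1,2}}" for S
    proof -
      have "S \<subseteq> {..<3}" "card S = 2" using that by auto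
      then show ?thesis using kchainsD[OF cK, of S] by simp
    qed
    have pJ: "Xv i * p \<in> ?J" if "i < 3" for i
    proof -
      have "i = 0 \<or> i = 1 \<or> i = 2" using that by auto
      moreover have "Xv 1 * p \<in> ?J" using cS[of "{0,2}"] p02 mono_ideal_uminus[of "- (Xv 1 * p)" M] by simp
      ultimately show ?thesis using cS[of "{0,1}"] cS[of "{1,2}"] p p12 by auto
    qed
    have c_tc: "c = kdiff (tc p)"
    proof (rule ext)
      fix S
      show "c S = kdiff (tc p) S"
      proof (cases "S \<subseteq> {..<3} \<and> card S = 2")
        case True
        then have "S \<in> {{0,1},{0,2},{1,2}}" using subset_less_3[of S] by auto
        then show ?thesis using p p12 p02
          by (elim insertE emptyE) (simp_all add: kdiff_pair[simplified] tc_def)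
      next
        case False
        have "kdiff (tc p) S = 0"
          unfolding kdiff_def
        proof (rule sum.neutral, rule ballI)
          fix t assume t: "t \<in> {..<3} - S"
          have "insert t S \<noteq> {0,1,2}"
          proof
            assume *: "insert t S = {0,1,2}"
            then have "finite (insert t S)" by simp
            then have "card (insert t S) = Suc (card S)" using t by simp
            then have "card S = 2" unfolding * by simp
            moreover have "S \<subseteq> {..<3}" unfolding e3 *[symmetric] by (rule subset_insertI)
            ultimately show False using False by blast
          qed
          then show "(- 1) ^ card {u \<in> S. u < t} * Xv t * tc p (insert t S) = 0" by (simp add: tc_def)
        qed
        then show ?thesis using kchains_zero[OF cK False] by simp
      qed
    qed
    have "p = (\<Sum>m\<in>Poly_Mapping.keys p. Poly_Mapping.single m (lookup p m))"
      by (rule sum_monomials) simp_all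
    then have tc: "tc p = (\<Sum>m\<in>Poly_Mapping.keys p. kscale (lookup p m) (tc (Poly_Mapping.single m 1)))"
      by (auto simp: fun_eq_iff sum_apply kscale_def tc_def const3_mult_single)
    interpret L: Vector_Spaces.linear kscale kscale "kdiff :: (nat set \<Rightarrow> 'k poly3) \<Rightarrow> _"
      by (rule linear_kdiff)
    have "c = (\<Sum>m\<in>Poly_Mapping.keys p. kscale (lookup p m) (kdiff (tc (Poly_Mapping.single m 1))))"
      unfolding c_tc tc by (simp add: L.sum kdiff_kscale)
    also have "\<dots> \<in> K.span (C \<union> ?G)"
    proof (intro K.span_sum K.span_scale)
      fix m assume m: "m \<in> Poly_Mapping.keys p"
      then have nz: "lookup p m \<noteq> 0" by (simp add: in_keys_iff)
      have M': "var_exp i + m \<in> M" if "i < 3" for i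
      proof -
        have "lookup (Xv i * p) (var_exp i + m) \<noteq> 0" using nz by (simp add: lookup_Xv_mult)
        then show ?thesis using pJ[OF that] unfolding mono_ideal_iff by blast
      qed
      have "lookup (Xv 2 * p) (var_exp 2 + m) \<noteq> 0" using nz by (simp add: lookup_Xv_mult)
      then have deg: "Suc (tdeg m) = d"
        using cS[of "{0,1}"] p unfolding homog_lookup by (metis insertI1 plus_1_eq_Suc tdeg_add tdeg_var_exp)
      \<comment> \<open>A monomial of p inside M gives a boundary of the complex of J. Outside M it
        is a socle monomial of R/J in degree d-1, so it is indexed by \<open>B\<close>.\<close>
      show "kdiff (tc (Poly_Mapping.single m 1)) \<in> K.span (C \<union> ?G)"
      proof (cases "m \<in> M")
        case True
        then have "tc (Poly_Mapping.single m 1) \<in> kchains ?J 3 (Suc (tdeg m) + 2)"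
          by (intro tcJ homog_single) (simp add: mono_ideal_def)
        then have "kdiff (tc (Poly_Mapping.single m 1)) \<in> ?B" using deg by simp
        then show ?thesis using C(4) K.span_mono[of C "C \<union> ?G"] by blast
      next
        case False
        then have "m \<in> B" using B(2) deg M' by blast
        then show ?thesis by (intro K.span_base) blast
      qed
    qed
    finally show "c \<in> K.span (C \<union> ?G)" .
  qed
  then have "K.dim ?Z \<le> card (C \<union> ?G)" using C(1) B(1) by (intro K.dim_le_card) auto
  also have "\<dots> \<le> card C + card ?G" by (rule card_Un_le)
  also have "\<dots> \<le> K.dim ?B + card B" using C(5) card_image_le[OF B(1)] by simp
  finally show ?thesis unfolding betti_def by (simp add: numeral_3_eq_3 numeral_2_eq_2)
qed

text \<open>Eliahou--Kervaire syzygies: for u with x_2 u a generator divisible by x_2, the relations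
  x_i (x_2 u) = x_2 (x_i u), i = 0, 1, are independent modulo boundaries, because x_2 u is not in
  the product of the maximal ideal with J.\<close>

lemma betti_1_ge:
  assumes M: "\<And>n m. m \<in> M \<Longrightarrow> n + m \<in> M"
    and borel: "\<And>i m. i < 2 \<Longrightarrow> var_exp 2 + m \<in> M \<Longrightarrow> var_exp i + m \<in> M"
    and B: "finite B" "\<And>u. u \<in> B \<Longrightarrow> tdeg u = d \<and> u \<notin> M \<and> var_exp 2 + u \<in> M"
  shows "2 * card B \<le> betti (mono_ideal M :: 'k::field poly3 set) 1 (d + 2)"
proof -
  let ?J = "mono_ideal M :: 'k poly3 set"
  let ?Z = "kchains ?J 1 (d + 2) \<inter> {c. kdiff c = 0}" and ?B = "kdiff ` kchains ?J 2 (d + 2)"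
  \<comment> \<open>For x = (u, i) this is the cycle x_2 u e_i - x_i u e_2. Borel exchange puts x_i
    u into M, so its entries do lie in J.\<close>
  define z :: "mon3 \<times> nat \<Rightarrow> nat set \<Rightarrow> 'k poly3" where
    "z x = (\<lambda>S. if S = {snd x} then Poly_Mapping.single (var_exp 2 + fst x) 1
      else if S = {2} then - Poly_Mapping.single (var_exp (snd x) + fst x) 1 else 0)" for x
  let ?A = "B \<times> {..<2::nat}"
  obtain W where W: "finite W" "?B \<subseteq> K.span W" by (rule kdiff_kchains_subset_span)
  obtain C where C: "finite C" "C \<subseteq> ?B" "K.independent C" "?B \<subseteq> K.span C" "card C = K.dim ?B"
    using K.finite_basis_exists[OF W(2,1)] by metis
  \<comment> \<open>If x_2 u = x_j n with n in M, then j = 2 gives u = n in M. For j < 2 write u =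
    x_j u'; then n = x_2 u' is in M, and Borel exchange again puts u in M.\<close>
  have gen: "lookup (Xv j * q) (var_exp 2 + u) = 0" if u: "u \<in> B" and q: "q \<in> ?J" and j: "j < 3" for j q u
  proof (rule ccontr)
    assume nz: "lookup (Xv j * q) (var_exp 2 + u) \<noteq> 0"
    then obtain n where n: "var_exp 2 + u = var_exp j + n" using lookup_Xv_mult_eq_0 by metis
    have "lookup q n \<noteq> 0" using nz unfolding n lookup_Xv_mult .
    then have nM: "n \<in> M" using q unfolding mono_ideal_iff by blast
    show False
    proof (cases "j = 2")
      case True
      then show False using n nM B(2)[OF u] by simp
    next
      case False
      then have j2: "j < 2" using j by simp
      have "expo (var_exp 2 + u) j \<noteq> 0" using j by (simp add: n expo_add expo_var_exp)
      then have "expo u j \<noteq> 0" using False j by (simp add: expo_add expo_var_exp)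
      then obtain u' where u': "u = var_exp j + u'" using var_exp_dvd_iff[OF j] by blast
      then have "var_exp j + (var_exp 2 + u') = var_exp j + n" using n by (simp add: ac_simps)
      then have "var_exp 2 + u' \<in> M" using nM by simp
      then show False using borel[OF j2] u' B(2)[OF u] by blast
    qed
  qed
  \<comment> \<open>Reading off the coefficient of x_2 u at e_i is a linear functional that vanishes
    on boundaries. These functionals detect the cycles \<open>z\<close>.\<close>
  have bd: "lookup (y {i}) (var_exp 2 + u) = 0" if y: "y \<in> K.span C" and "i < 2" "u \<in> B" for y i u
  proof -
    let ?S = "{y :: nat set \<Rightarrow> 'k poly3. lookup (y {i}) (var_exp 2 + u) = 0}"
    have "K.subspace ?S"
      by (rule K.subspaceI) (simp_all add: lookup_add kscale_def)
    moreover have "?B \<subseteq> ?S"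
    proof
      fix y assume "y \<in> ?B"
      then obtain c where c: "c \<in> kchains ?J 2 (d + 2)" "y = kdiff c" by blast
      have "c S \<in> ?J" if "S \<in> {{0,1},{0,2},{1,2}}" for S
      proof -
        have "S \<subseteq> {..<3}" "card S = 2" using that by auto
        then show ?thesis using kchainsD[OF c(1), of S] by simp
      qed
      then have cJ: "c {0,1} \<in> ?J" "c {0,2} \<in> ?J" "c {1,2} \<in> ?J" by simp_all
      have "i = 0 \<or> i = 1" using \<open>i < 2\<close> by auto
      then have "lookup (y {i}) (var_exp 2 + u) = 0"
      proof
        assume "i = 0"
        then have "y {i} = - (Xv 1 * c {0,1}) - Xv 2 * c {0,2}" using kdiff_singleton(1) c(2) by simp
        then show ?thesis
          using gen[OF \<open>u \<in> B\<close> cJ(1), of 1] gen[OF \<open>u \<in> B\<close> cJ(2), of 2] by (simp add: lookup_minus)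
      next
        assume "i = 1"
        then have "y {i} = Xv 0 * c {0,1} - Xv 2 * c {1,2}" using kdiff_singleton(2) c(2) by simp
        then show ?thesis
          using gen[OF \<open>u \<in> B\<close> cJ(1), of 0] gen[OF \<open>u \<in> B\<close> cJ(3), of 2] by (simp add: lookup_minus)
      qed
      then show "y \<in> ?S" by simp
    qed
    ultimately have "K.span C \<subseteq> ?S" using C(2) by (intro K.span_minimal) auto
    then show ?thesis using y by blast
  qed
  have indep: "K.independent (C \<union> z ` ?A) \<and> card (C \<union> z ` ?A) = card C + card ?A"
  proof (rule K.independent_relative[OF C(3,1)])
    show "finite ?A" using B(1) by simp
    fix a assume a: "(\<Sum>x\<in>?A. kscale (a x) (z x)) \<in> K.span C"
    show "\<forall>x\<in>?A. a x = 0"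
    proof
      fix x assume x: "x \<in> ?A"
      then have ui: "fst x \<in> B" "snd x < 2" by auto
      \<comment> \<open>Since i < 2, the e_2 components do not interfere, and the functional
        attached to x takes the value 1 on \<open>z x\<close> and 0 on the other cycles.\<close>
      have "lookup ((\<Sum>y\<in>?A. kscale (a y) (z y)) {snd x}) (var_exp 2 + fst x)
        = (\<Sum>y\<in>?A. if y = x then a x else 0)"
        unfolding sum_apply lookup_sum
      proof (rule sum.cong[OF refl])
        fix y assume y: "y \<in> ?A"
        show "lookup (kscale (a y) (z y) {snd x}) (var_exp 2 + fst x) = (if y = x then a x else 0)"
          using ui by (cases x; cases y) (auto simp: kscale_def z_def lookup_single when_def)
      qed
      also have "\<dots> = a x" using x B(1) by simp
      finally show "a x = 0" using bd[OF a ui(2,1)] by simp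
    qed
  qed
  have zZ: "z x \<in> ?Z" if x: "x \<in> ?A" for x
  proof -
    obtain u i where ui: "x = (u, i)" "u \<in> B" "i < 2" using x by auto
    have u: "tdeg u = d" "var_exp 2 + u \<in> M" "var_exp i + u \<in> M" using B(2)[OF ui(2)] borel ui(3) by auto
    have hom: "homog (Suc d) (Poly_Mapping.single (var_exp j + u) (1::'k))" for j
      using homog_single[of "var_exp j + u"] u(1) by simp
    have J: "Poly_Mapping.single (var_exp 2 + u) 1 \<in> ?J" "- Poly_Mapping.single (var_exp i + u) 1 \<in> ?J"
      using u by (auto intro!: mono_ideal_uminus simp: mono_ideal_def)
    have "z x \<in> kchains ?J 1 (d + 2)"
      unfolding kchains_def mem_Collect_eq
    proof
      fix S
      have "0 \<in> ?J" by (simp add: mono_ideal_def)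
      moreover have "card {i} = 1" "card {2::nat} = 1" "{i} \<subseteq> {..<3}" "{2::nat} \<subseteq> {..<3}" using ui by auto
      ultimately show "if S \<subseteq> {..<3} \<and> card S = 1 \<and> 1 \<le> d + 2 then z x S \<in> ?J \<and> homog (d + 2 - 1) (z x S) else z x S = 0"
        using J hom homog_uminus[OF hom] by (auto simp: z_def ui(1))
    qed
    moreover have "kdiff (z x) = 0"
    proof (rule ext)
      fix T
      show "kdiff (z x) T = 0 T"
      proof (cases "T = {}")
        case True
        have "i = 0 \<or> i = 1" using ui by auto
        then show ?thesis unfolding True kdiff_empty
          by (auto simp: z_def ui(1) Xv_mult_single ac_simps)
      next
        case False
        have "z x (insert t T) = 0" if "t \<notin> T" for t
        proof -
          have "insert t T \<noteq> {i}" "insert t T \<noteq> {2}" using False that by auto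
          then show ?thesis unfolding z_def ui(1) by (simp only: fst_conv snd_conv if_False)
        qed
        then show ?thesis by (simp add: kdiff_def sum.neutral)
      qed
    qed
    ultimately show ?thesis by simp
  qed
  \<comment> \<open>Boundaries are cycles. This places \<open>C\<close> inside the cycle space, so
    that \<open>C\<close> and the cycles \<open>z\<close> are counted together there.\<close>
  have BZ: "?B \<subseteq> ?Z"
  proof
    fix y assume "y \<in> ?B"
    then obtain c where c: "c \<in> kchains ?J 2 (d + 2)" "y = kdiff c" by blast
    have cJ': "c S \<in> ?J \<and> homog d (c S)" if "S \<in> {{0,1},{0,2},{1,2}}" for S
    proof -
      have "S \<subseteq> {..<3}" "card S = 2" using that by auto
      then show ?thesis using kchainsD[OF c(1), of S] by simp
    qed
    have J: "Xv j * c S \<in> ?J" and hom: "homog (Suc d) (Xv j * c S)"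
      if "S \<in> {{0,1},{0,2},{1,2}}" for j S
      using cJ'[OF that] mono_ideal_Xv_mult[OF M] homog_Xv_mult by blast+
    have y0: "y T = 0" if "\<not> (T \<subseteq> {..<3} \<and> card T = 1)" for T
      using kdiff_zero[of c ?J 1 "d + 2" T] c that by (simp add: numeral_2_eq_2)
    have y1: "y T \<in> ?J \<and> homog (Suc d) (y T)" if T: "T \<subseteq> {..<3}" "card T = 1" for T
    proof -
      have "T = {0} \<or> T = {1} \<or> T = {2}" using subset_less_3[OF T(1)] T(2) by auto
      then show ?thesis
        unfolding c(2)
        by (elim disjE) (simp_all only: kdiff_singleton, simp_all add: J hom mono_ideal_diff
            mono_ideal_add mono_ideal_uminus homog_diff homog_add homog_uminus)
    qed
    have "y \<in> kchains ?J 1 (d + 2)"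
      unfolding kchains_def mem_Collect_eq using y0 y1 by simp
    moreover have "kdiff y = 0"
    proof (rule ext)
      fix T
      show "kdiff y T = 0 T"
      proof (cases "T = {}")
        case True
        show ?thesis unfolding True kdiff_empty c(2) kdiff_singleton
          by (simp add: algebra_simps)
      next
        case False
        then have "\<not> (T \<subseteq> {..<3} \<and> card T = 0)" using finite_subset[of T "{..<3}"] by auto
        then show ?thesis using kdiff_zero[of y ?J 0 "d + 2" T] \<open>y \<in> kchains ?J 1 (d + 2)\<close> by simp
      qed
    qed
    ultimately show "y \<in> ?Z" by simp
  qed
  have "card (C \<union> z ` ?A) \<le> K.dim ?Z"
  proof (rule K.independent_card_le_dim_span)
    show "K.independent (C \<union> z ` ?A)" using indep by blast
    show "C \<union> z ` ?A \<subseteq> ?Z" using C(2) BZ zZ by blast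
    show "?Z \<subseteq> K.span ((\<lambda>(T, m). monomial_chain T m) ` (Pow {..<3} \<times> {m. tdeg m = d + 2 - 1}))"
      using kchains_subset_span[of ?J 1 "d + 2"] by blast
  qed (rule finite_monomial_chains)
  moreover have "card ?A = 2 * card B" by (simp add: card_cartesian_product)
  ultimately have "2 * card B \<le> K.dim ?Z - K.dim ?B" using indep C(5) by simp
  then show ?thesis unfolding betti_def by (simp add: numeral_2_eq_2)
qed

section \<open>Linear systems\<close>

text \<open>Eliminate one unknown per equation. Systems are indexed by finite sets of monomials, so
  that the kernels in A, being subspaces of a quotient, never have to be formed.\<close>

lemma underdetermined_system:
  fixes N :: "'a \<Rightarrow> 'b \<Rightarrow> 'k::field"
  assumes "finite W" "finite U" "card W < card U"
  shows "\<exists>c. (\<exists>u\<in>U. c u \<noteq> 0) \<and> (\<forall>r\<in>W. (\<Sum>u\<in>U. N r u * c u) = 0)"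
  using assms
proof (induction W arbitrary: N U rule: finite_induct)
  case empty
  then obtain u where "u \<in> U" by (auto simp: card_gt_0_iff)
  then show ?case by (intro exI[of _ "\<lambda>_. 1"]) auto
next
  case (insert w W)
  show ?case
  proof (cases "\<forall>u\<in>U. N w u = 0")
    case True
    then show ?thesis using insert.IH[OF insert.prems(1), of N] insert.prems insert.hyps by auto
  next
    case False
    then obtain v where v: "v \<in> U" "N w v \<noteq> 0" by blast
    let ?N = "\<lambda>r u. N r u - N r v * N w u / N w v"
    have "card W < card (U - {v})" using insert.prems insert.hyps v by simp
    then obtain c where c: "\<exists>u\<in>U - {v}. c u \<noteq> 0" "\<And>r. r \<in> W \<Longrightarrow> (\<Sum>u\<in>U - {v}. ?N r u * c u) = 0"
      using insert.IH[of "U - {v}" ?N] insert.prems(1) by auto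
    define S where "S = (\<Sum>u\<in>U - {v}. N w u * c u)"
    define c' where "c' = c(v := - S / N w v)"
    have split: "(\<Sum>u\<in>U. N r u * c' u) = (\<Sum>u\<in>U - {v}. N r u * c u) - N r v * S / N w v" for r
    proof -
      have "(\<Sum>u\<in>U. N r u * c' u) = N r v * c' v + (\<Sum>u\<in>U - {v}. N r u * c' u)"
        using v insert.prems(1) by (simp add: sum.remove)
      also have "(\<Sum>u\<in>U - {v}. N r u * c' u) = (\<Sum>u\<in>U - {v}. N r u * c u)"
        by (rule sum.cong) (auto simp: c'_def)
      finally show ?thesis by (simp add: c'_def)
    qed
    have "(\<Sum>u\<in>U. N r u * c' u) = 0" if r: "r \<in> insert w W" for r
    proof (cases "r = w")
      case True
      then show ?thesis using v by (simp add: split S_def)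
    next
      case False
      then have "(\<Sum>u\<in>U - {v}. ?N r u * c u) = 0" using c(2) r by blast
      moreover have "(\<Sum>u\<in>U - {v}. ?N r u * c u) = (\<Sum>u\<in>U - {v}. N r u * c u) - N r v * S / N w v"
        by (simp add: S_def left_diff_distrib sum_subtractf sum_distrib_left sum_divide_distrib mult.assoc)
      ultimately show ?thesis by (simp add: split)
    qed
    moreover have "\<exists>u\<in>U. c' u \<noteq> 0" using c(1) by (auto simp: c'_def)
    ultimately show ?thesis by blast
  qed
qed

lemma injective_system_card_le:
  fixes N :: "'a \<Rightarrow> 'b \<Rightarrow> 'k::field"
  assumes "finite W" "finite U"
    and "\<And>c. (\<And>r. r \<in> W \<Longrightarrow> (\<Sum>u\<in>U. N r u * c u) = 0) \<Longrightarrow> \<forall>u\<in>U. c u = 0"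
  shows "card U \<le> card W"
proof (rule ccontr)
  assume "\<not> ?thesis"
  then obtain c where "\<exists>u\<in>U. c u \<noteq> 0" "\<forall>r\<in>W. (\<Sum>u\<in>U. N r u * c u) = 0"
    using underdetermined_system[OF assms(1,2), of N] by auto
  then show False using assms(3)[of c] by blast
qed

lemma injective_system_surjective:
  fixes N :: "'a \<Rightarrow> 'b \<Rightarrow> 'k::field"
  assumes fin: "finite W" "finite U" and le: "card W \<le> card U"
    and inj: "\<And>c. (\<And>r. r \<in> W \<Longrightarrow> (\<Sum>u\<in>U. N r u * c u) = 0) \<Longrightarrow> \<forall>u\<in>U. c u = 0"
  shows "\<exists>c. \<forall>r\<in>W. (\<Sum>u\<in>U. N r u * c u) = t r"
proof -
  \<comment> \<open>The target -t is adjoined as a column \<open>None\<close>. Injectivity forces a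
    nontrivial solution of the enlarged system to have a nonzero \<open>None\<close> entry, and
    dividing by that entry solves the original system.\<close>
  let ?U = "insert None (Some ` U)"
  let ?N = "\<lambda>r u. case u of None \<Rightarrow> - t r | Some u \<Rightarrow> N r u"
  have "card W < card ?U" using fin le by (simp add: card_image)
  then obtain c where c: "\<exists>u\<in>?U. c u \<noteq> 0" "\<forall>r\<in>W. (\<Sum>u\<in>?U. ?N r u * c u) = 0"
    using underdetermined_system[OF fin(1), of ?U ?N] fin(2) by blast
  have eq: "(\<Sum>u\<in>U. N r u * c (Some u)) = t r * c None" if "r \<in> W" for r
    using c(2) that fin(2) by (simp add: sum.reindex)
  have nz: "c None \<noteq> 0"
  proof
    assume 0: "c None = 0"
    then have "\<forall>u\<in>U. c (Some u) = 0" using inj[of "\<lambda>u. c (Some u)"] eq by simp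
    then show False using c(1) 0 by auto
  qed
  have "(\<Sum>u\<in>U. N r u * (c (Some u) / c None)) = t r" if "r \<in> W" for r
    using eq[OF that] nz by (simp flip: sum_divide_distrib)
  then show ?thesis by (intro exI[of _ "\<lambda>u. c (Some u) / c None"]) blast
qed

section \<open>The kernel of multiplication by the last variable\<close>

text \<open>The defining feature of reverse lexicographic order: if x_2 divides the leading monomial
  of a homogeneous polynomial, it divides all of its monomials. A form in I with leading monomial
  x_2 u thus yields a kernel element led by u.\<close>

lemma lead_set_last_variable:
  assumes I: "homogeneous_ideal I" and u: "var_exp 2 + u \<in> lead_set I"
  shows "\<exists>f. homog (tdeg u) f \<and> f \<noteq> 0 \<and> lead_mon f = u \<and> Xv 2 * f \<in> I"
proof -
  obtain F where F: "F \<in> I" "F \<noteq> 0" "homog (tdeg (var_exp 2 + u)) F" "lead_mon F = var_exp 2 + u"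
    using lead_set_homog[OF I u] by metis
  have "\<exists>n. m = var_exp 2 + n" if m: "lookup F m \<noteq> 0" for m
  proof -
    have "\<not> revlex_less (var_exp 2 + u) m"
      using lookup_above_lead_mon[OF F(2)] F(4) m by metis
    moreover have "tdeg m = tdeg (var_exp 2 + u)" using F(3) m unfolding homog_lookup by blast
    ultimately have "expo (var_exp 2 + u) 2 \<le> expo m 2"
      unfolding revlex_less_def by auto
    then have "expo m 2 \<noteq> 0" by (simp add: expo_add expo_var_exp)
    then show ?thesis using var_exp_dvd_iff[of 2 m] by simp
  qed
  then obtain f where f: "F = Xv 2 * f" using Xv_factor by metis
  have nz: "lookup f u \<noteq> 0" using lookup_lead_mon[OF F(2)] F(4) by (simp add: f lookup_Xv_mult)
  have "lead_mon f = u"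
  proof (rule lead_mon_eqI[OF nz])
    fix m assume "revlex_less u m"
    then have "lookup F (var_exp 2 + m) = 0" using lookup_above_lead_mon[OF F(2)] F(4) by simp
    then show "lookup f m = 0" by (simp add: f lookup_Xv_mult)
  qed
  moreover have "homog (tdeg u) f" using F(3) homog_Xv_mult_iff by (simp add: f)
  moreover have "f \<noteq> 0" using nz by auto
  ultimately show ?thesis using F(1) f by blast
qed

text \<open>Cancel leading terms. If the leading monomial l of p is in \<open>lead_set I\<close>,
  subtract a multiple of an element of I. Otherwise x_2 l leads x_2 p, which is in I, so l is in
  \<open>B\<close> and a multiple of \<open>f l\<close> does it.\<close>

lemma kernel_spanning:
  fixes I :: "'k::field poly3 set"
  assumes I: "homogeneous_ideal I"
    and B: "finite B" "\<And>u. tdeg u = d \<Longrightarrow> u \<notin> lead_set I \<Longrightarrow> var_exp 2 + u \<in> lead_set I \<Longrightarrow> u \<in> B"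
    and f: "\<And>u. u \<in> B \<Longrightarrow> homog d (f u) \<and> f u \<noteq> 0 \<and> lead_mon (f u) = u \<and> Xv 2 * f u \<in> I"
    and p: "homog d p" "Xv 2 * p \<in> I"
  shows "\<exists>a. p - (\<Sum>w\<in>B. const3 (a w) * f w) \<in> I"
  using p
\<comment> \<open>The condition that p is nonzero gives the zero polynomial measure 0, where
  \<open>lead_mon\<close> carries no information.\<close>
proof (induction "card {m. tdeg m = d \<and> p \<noteq> 0 \<and> \<not> revlex_less (lead_mon p) m}" arbitrary: p rule: less_induct)
  case less
  note I0 = homogeneous_ideal_is_ideal[OF I]
  let ?below = "\<lambda>p :: 'k poly3. {m. tdeg m = d \<and> p \<noteq> 0 \<and> \<not> revlex_less (lead_mon p) m}"
  show ?case
  proof (cases "p = 0")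
    case True
    then show ?thesis using is_ideal_0[OF I0] by (intro exI[of _ "\<lambda>_. 0"]) simp
  next
    case False
    let ?l = "lead_mon p"
    have l: "tdeg ?l = d" using homog_lead_mon[OF less.prems(1) False] .
    have step: "\<exists>a. p - const3 (lookup p ?l / lookup q ?l) * q - (\<Sum>w\<in>B. const3 (a w) * f w) \<in> I"
      if q: "homog d q" "q \<noteq> 0" "lead_mon q = ?l" "Xv 2 * q \<in> I" for q
    proof -
      let ?p' = "p - const3 (lookup p ?l / lookup q ?l) * q"
      have hom: "homog d ?p'" by (intro homog_diff homog_const3_mult less.prems q)
      have X: "Xv 2 * ?p' \<in> I"
        using is_ideal_diff[OF I0 less.prems(2) is_ideal_mult[OF I0 q(4)], of "const3 (lookup p ?l / lookup q ?l)"]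
        by (simp add: right_diff_distrib ac_simps)
      have "lookup q ?l \<noteq> 0" using lookup_lead_mon[OF q(2)] q(3) by simp
      then have pl: "lookup ?p' ?l = 0" by (simp add: lookup_minus)
      have above: "lookup ?p' m = 0" if "revlex_less ?l m" for m
        using lookup_above_lead_mon[OF False that] lookup_above_lead_mon[OF q(2), of m] q(3) that
        by (simp add: lookup_minus)
      have lt: "revlex_less (lead_mon ?p') ?l" if "?p' \<noteq> 0"
        using lookup_lead_mon[OF that] pl above revlex_total by metis
      have "?below ?p' \<subset> ?below p"
      proof (rule psubsetI)
        show "?below ?p' \<subseteq> ?below p"
        proof
          fix m assume m: "m \<in> ?below ?p'"
          then have "\<not> revlex_less ?l m" using lt revlex_trans by blast
          then show "m \<in> ?below p" using m False by blast
        qed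
        have "?l \<in> ?below p" using l False revlex_irrefl by blast
        moreover have "?l \<notin> ?below ?p'" using lt by blast
        ultimately show "?below ?p' \<noteq> ?below p" by blast
      qed
      then have "card (?below ?p') < card (?below p)"
        by (intro psubset_card_mono finite_subset[OF _ finite_tdeg[of d]]) auto
      then show ?thesis using less.hyps hom X by blast
    qed
    show ?thesis
    proof (cases "?l \<in> lead_set I")
      case True
      then obtain q where q: "q \<in> I" "q \<noteq> 0" "homog d q" "lead_mon q = ?l"
        using lead_set_homog[OF I True] l by metis
      let ?c = "const3 (lookup p ?l / lookup q ?l)"
      obtain a where a: "p - ?c * q - (\<Sum>w\<in>B. const3 (a w) * f w) \<in> I"
        using step[OF q(3,2,4) is_ideal_mult[OF I0 q(1)]] by blast
      have "p - (\<Sum>w\<in>B. const3 (a w) * f w) \<in> I"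
        using is_ideal_add[OF I0 a is_ideal_mult[OF I0 q(1), of ?c]] by (simp add: algebra_simps)
      then show ?thesis by blast
    next
      case lM: False
      have "lead_mon (Poly_Mapping.single (var_exp 2) 1 * p) \<in> lead_set I"
        using single_1_mult_lead(1)[OF False, of "var_exp 2"] less.prems(2)
        unfolding lead_set_def Xv_single by blast
      then have lB: "?l \<in> B" using B(2)[OF l lM] single_1_mult_lead(2)[OF False] by metis
      let ?c = "lookup p ?l / lookup (f ?l) ?l"
      obtain a where a: "p - const3 ?c * f ?l - (\<Sum>w\<in>B. const3 (a w) * f w) \<in> I"
        using step[of "f ?l"] f[OF lB] by blast
      have "(\<Sum>w\<in>B. const3 ((a(?l := a ?l + ?c)) w) * f w)
        = (\<Sum>w\<in>B. const3 (a w) * f w + (if w = ?l then const3 ?c * f ?l else 0))"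
        by (rule sum.cong) (simp_all add: const3_add distrib_right)
      also have "\<dots> = (\<Sum>w\<in>B. const3 (a w) * f w) + const3 ?c * f ?l"
        using lB B(1) by (simp add: sum.distrib)
      finally have "p - (\<Sum>w\<in>B. const3 ((a(?l := a ?l + ?c)) w) * f w) \<in> I"
        using a by (simp add: algebra_simps)
      then show ?thesis by blast
    qed
  qed
qed

text \<open>The f u have distinct leading monomials, so the largest u with nonzero coefficient leads
  the sum; it would then be in \<open>lead_set I\<close>.\<close>

lemma kernel_independent:
  fixes I :: "'k::field poly3 set"
  assumes B: "finite B" "\<And>u. u \<in> B \<Longrightarrow> u \<notin> lead_set I"
    and f: "\<And>u. u \<in> B \<Longrightarrow> f u \<noteq> 0 \<and> lead_mon (f u) = u"
    and c: "(\<Sum>u\<in>B. const3 (c u) * f u) \<in> I"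
  shows "\<forall>u\<in>B. c u = 0"
proof (rule ccontr)
  let ?v = "\<Sum>u\<in>B. const3 (c u) * f u"
  let ?S = "{u \<in> B. c u \<noteq> 0}"
  assume "\<not> ?thesis"
  then have "?S \<noteq> {}" by blast
  moreover have "finite ?S" using B(1) by simp
  ultimately have "\<exists>m\<in>?S. \<forall>m'\<in>?S. m' \<noteq> m \<longrightarrow> revlex_less m' m" by (intro revlex_max_exists)
  then obtain m where m: "m \<in> B" "c m \<noteq> 0" "\<And>u. u \<in> B \<Longrightarrow> c u \<noteq> 0 \<Longrightarrow> u \<noteq> m \<Longrightarrow> revlex_less u m" by blast
  have look: "lookup ?v n = (\<Sum>u\<in>B. c u * lookup (f u) n)" for n by (simp add: lookup_sum)
  have "lookup ?v m = (\<Sum>u\<in>B. if u = m then c m * lookup (f m) m else 0)"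
    unfolding look
  proof (rule sum.cong[OF refl])
    fix u assume u: "u \<in> B"
    show "c u * lookup (f u) m = (if u = m then c m * lookup (f m) m else 0)"
      using m(3)[OF u] f[OF u] lookup_above_lead_mon[of "f u" m] by (cases "c u = 0") auto
  qed
  also have "\<dots> = c m * lookup (f m) m" using m(1) B(1) by simp
  finally have nz: "lookup ?v m \<noteq> 0" using m(2) f[OF m(1)] lookup_lead_mon[of "f m"] by simp
  have "lead_mon ?v = m"
  proof (rule lead_mon_eqI[OF nz])
    fix n assume n: "revlex_less m n"
    show "lookup ?v n = 0"
      unfolding look
    proof (rule sum.neutral, rule ballI)
      fix u assume u: "u \<in> B"
      show "c u * lookup (f u) n = 0"
      proof (cases "c u = 0")
        case False
        then have "revlex_less u n" using m(3)[OF u] n revlex_trans by metis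
        then show ?thesis using f[OF u] lookup_above_lead_mon[of "f u" n] by simp
      qed simp
    qed
  qed
  moreover have "?v \<noteq> 0" using nz by auto
  ultimately have "m \<in> lead_set I" using c unfolding lead_set_def by blast
  then show False using B(2)[OF m(1)] by blast
qed

text \<open>All of A_s is in the socle, because products with variables land in A_(s+1) = 0. The
  single socle degree of a level A is therefore s.\<close>

lemma level_socle:
  assumes lev: "level I" and s: "socle_degree I s" and p: "in_socle I p" "homog e p" "e \<noteq> s"
  shows "p \<in> I"
proof -
  obtain t where t: "\<And>p d. in_socle I p \<Longrightarrow> d \<noteq> t \<Longrightarrow> hcomp d p \<in> I"
    using lev unfolding level_def by blast
  obtain q where q: "homog s q" "q \<notin> I" using s unfolding socle_degree_def A_nonzero_in_def by blast
  have "Xv i * q \<in> I" for i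
    using s homog_Xv_mult[OF q(1), of i] unfolding socle_degree_def A_nonzero_in_def by blast
  then have "in_socle I q" by (simp add: in_socle_def)
  then have "s = t" using t[of q s] q hcomp_homog[OF q(1), of s] by auto
  then show ?thesis using t[OF p(1), of e] p(3) hcomp_homog[OF p(2), of e] by simp
qed

text \<open>B0 and B1 index bases of the kernels of multiplication by x_2 on A_(d-1) and A_d.\<close>

lemma not_level_if_kernel_drops:
  fixes I :: "'k::field poly3 set"
  assumes I: "homogeneous_ideal I" and s: "socle_degree I s" and ds: "d < s"
    and B0: "B0 = {u. Suc (tdeg u) = d \<and> u \<notin> lead_set I \<and> var_exp 2 + u \<in> lead_set I}"
    and B1: "B1 = {u. tdeg u = d \<and> u \<notin> lead_set I \<and> var_exp 2 + u \<in> lead_set I}"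
    and le: "2 * card B1 \<le> card B0" and ne: "B0 \<noteq> {}"
  shows "\<not> level I"
proof
  assume lev: "level I"
  note I0 = homogeneous_ideal_is_ideal[OF I]
  have fin1: "finite B1" by (rule finite_subset[OF _ finite_tdeg[of d]]) (use B1 in blast)
  have fin0: "finite B0" by (rule finite_subset[OF _ finite_tdeg[of "d - 1"]]) (use B0 in auto)
  obtain f where f: "\<And>u. var_exp 2 + u \<in> lead_set I \<Longrightarrow>
      homog (tdeg u) (f u) \<and> f u \<noteq> 0 \<and> lead_mon (f u) = u \<and> Xv 2 * f u \<in> I"
    using lead_set_last_variable[OF I] by metis
  have f1: "homog d (f w) \<and> f w \<noteq> 0 \<and> lead_mon (f w) = w \<and> Xv 2 * f w \<in> I" if "w \<in> B1" for w
    using f[of w] that B1 by blast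
  have f0: "homog (d - 1) (f u)" "f u \<noteq> 0 \<and> lead_mon (f u) = u" "Xv 2 * f u \<in> I" "Suc (d - 1) = d"
    if "u \<in> B0" for u
    using f[of u] that unfolding B0 by auto
  have ex: "\<exists>a. Xv i * f u - (\<Sum>w\<in>B1. const3 (a w) * f w) \<in> I" if u: "u \<in> B0" for i u
  proof (rule kernel_spanning[OF I fin1 _ f1])
    show "homog d (Xv i * f u)" using homog_Xv_mult[OF f0(1)[OF u], of i] f0(4)[OF u] by simp
    have "Xv i * (Xv 2 * f u) \<in> I" by (rule is_ideal_mult[OF I0 f0(3)[OF u]])
    then show "Xv 2 * (Xv i * f u) \<in> I" by (simp add: ac_simps)
  qed (use B1 in blast)
  \<comment> \<open>The matrix of multiplication by x_i from the kernel in degree d-1 to the kernel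
    in degree d, relative to the bases of classes of f.\<close>
  define a where "a i u = (SOME a. Xv i * f u - (\<Sum>w\<in>B1. const3 (a w) * f w) \<in> I)" for i u
  have a: "Xv i * f u - (\<Sum>w\<in>B1. const3 (a i u w) * f w) \<in> I" if "u \<in> B0" for i u
    unfolding a_def by (rule someI_ex[OF ex[OF that]])
  define v where "v c = (\<Sum>u\<in>B0. const3 (c u) * f u)" for c
  \<comment> \<open>The combined matrix of v \<mapsto> (x_0 v, x_1 v); the row (w, i) is the
    w-coordinate of x_i v.\<close>
  define N where "N r u = a (snd r) u (fst r)" for r u
  let ?W = "B1 \<times> {..<2::nat}"
  have finW: "finite ?W" using fin1 by simp
  have cardW: "card ?W = 2 * card B1" by (simp add: card_cartesian_product)
  have Xv_v: "Xv i * v c - (\<Sum>w\<in>B1. const3 (\<Sum>u\<in>B0. N (w, i) u * c u) * f w) \<in> I" for i c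
  proof -
    have c3: "const3 (\<Sum>u\<in>B0. g u) = (\<Sum>u\<in>B0. const3 (g u))" for g :: "mon3 \<Rightarrow> 'k"
      using fin0 by induction (simp_all add: const3_add)
    have "(\<Sum>w\<in>B1. const3 (\<Sum>u\<in>B0. N (w, i) u * c u) * f w)
      = (\<Sum>w\<in>B1. \<Sum>u\<in>B0. const3 (c u) * (const3 (a i u w) * f w))"
      unfolding c3 sum_distrib_right by (simp add: N_def const3_mult ac_simps)
    also have "\<dots> = (\<Sum>u\<in>B0. const3 (c u) * (\<Sum>w\<in>B1. const3 (a i u w) * f w))"
      unfolding sum_distrib_left by (rule sum.swap)
    finally have "Xv i * v c - (\<Sum>w\<in>B1. const3 (\<Sum>u\<in>B0. N (w, i) u * c u) * f w)
      = (\<Sum>u\<in>B0. const3 (c u) * (Xv i * f u - (\<Sum>w\<in>B1. const3 (a i u w) * f w)))"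
      by (simp add: v_def right_diff_distrib sum_subtractf sum_distrib_left[of "Xv i"] ac_simps)
    also have "\<dots> \<in> I" by (rule is_ideal_sum[OF I0]) (rule is_ideal_mult[OF I0 a])
    finally show ?thesis .
  qed
  have v2: "Xv 2 * v c \<in> I" for c
  proof -
    have "Xv 2 * v c = (\<Sum>u\<in>B0. const3 (c u) * (Xv 2 * f u))"
      by (simp add: v_def sum_distrib_left ac_simps)
    also have "\<dots> \<in> I" by (rule is_ideal_sum[OF I0]) (rule is_ideal_mult[OF I0 f0(3)])
    finally show ?thesis .
  qed
  have socle: "in_socle I p" if "Xv 0 * p \<in> I" "Xv 1 * p \<in> I" "Xv 2 * p \<in> I" for p
    using that by (auto simp: in_socle_def less_Suc_eq numeral_3_eq_3 numeral_2_eq_2)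
  \<comment> \<open>A vector in the null space of \<open>N\<close> gives an element killed by x_0
    and x_1, and by x_2 as well since it lies in the kernel: a socle element of degree d-1, which
    level A does not have.\<close>
  have inj: "\<forall>u\<in>B0. c u = 0" if c: "\<And>r. r \<in> ?W \<Longrightarrow> (\<Sum>u\<in>B0. N r u * c u) = 0" for c
  proof -
    have "Xv i * v c \<in> I" if "i < 2" for i
      using Xv_v[of i c] c that by simp
    then have "in_socle I (v c)" using v2 by (intro socle) auto
    moreover have "homog (d - 1) (v c)"
      unfolding v_def by (intro homog_sum homog_const3_mult f0(1))
    ultimately have "v c \<in> I" using level_socle[OF lev s] ds by (metis less_imp_diff_less nat_neq_iff)
    then show ?thesis
      unfolding v_def using kernel_independent[OF fin0 _ f0(2), of I c] B0 by blast
  qed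
  have "card B0 \<le> card ?W" by (rule injective_system_card_le[OF finW fin0 inj])
  then have "B1 \<noteq> {}" using ne fin0 cardW by auto
  then obtain w where w: "w \<in> B1" by blast
  have surj: "\<exists>c. \<forall>r\<in>?W. (\<Sum>u\<in>B0. N r u * c u) = t r" for t
    by (rule injective_system_surjective[OF finW fin0 _ inj]) (use cardW le in simp_all)
  \<comment> \<open>Preimages of (f w, 0) for j = 0 and of (0, f w) for j = 1.\<close>
  have hit: "\<exists>c. \<forall>i<2. Xv i * v c - (if i = j then f w else 0) \<in> I" for j
  proof -
    obtain c where c: "\<And>r. r \<in> ?W \<Longrightarrow> (\<Sum>u\<in>B0. N r u * c u) = (if r = (w, j) then 1 else 0)"
      using surj[of "\<lambda>r. if r = (w, j) then 1 else 0"] by blast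
    have "Xv i * v c - (if i = j then f w else 0) \<in> I" if i: "i < 2" for i
    proof -
      have "(\<Sum>x\<in>B1. const3 (\<Sum>u\<in>B0. N (x, i) u * c u) * f x)
        = (\<Sum>x\<in>B1. if x = w then (if i = j then f w else 0) else 0)"
        by (rule sum.cong[OF refl]) (use c i in auto)
      also have "\<dots> = (if i = j then f w else 0)" using w fin1 by simp
      finally show ?thesis using Xv_v[of i c] by simp
    qed
    then show ?thesis by blast
  qed
  obtain c0 where c0: "\<And>i. i < 2 \<Longrightarrow> Xv i * v c0 - (if i = 0 then f w else 0) \<in> I" using hit[of 0] by blast
  obtain c1 where c1: "\<And>i. i < 2 \<Longrightarrow> Xv i * v c1 - (if i = 1 then f w else 0) \<in> I" using hit[of 1] by blast
  have a0: "Xv 0 * v c0 - f w \<in> I" "Xv 1 * v c0 \<in> I" using c0[of 0] c0[of 1] by simp_all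
  have a1: "Xv 0 * v c1 \<in> I" "Xv 1 * v c1 - f w \<in> I" using c1[of 0] c1[of 1] by simp_all
  \<comment> \<open>Modulo I, x_1 f w = x_1 x_0 v = x_0 x_1 v = 0 for the first preimage v; the
    second one gives x_0 f w = 0 in the same way.\<close>
  have "Xv 0 * (Xv 1 * v c0) - Xv 1 * (Xv 0 * v c0 - f w) \<in> I"
    by (rule is_ideal_diff[OF I0 is_ideal_mult[OF I0 a0(2)] is_ideal_mult[OF I0 a0(1)]])
  then have s1: "Xv 1 * f w \<in> I" by (simp add: algebra_simps)
  have "Xv 1 * (Xv 0 * v c1) - Xv 0 * (Xv 1 * v c1 - f w) \<in> I"
    by (rule is_ideal_diff[OF I0 is_ideal_mult[OF I0 a1(1)] is_ideal_mult[OF I0 a1(2)]])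
  then have s0: "Xv 0 * f w \<in> I" by (simp add: algebra_simps)
  have "in_socle I (f w)" using socle[OF s0 s1] f1[OF w] by blast
  then have "f w \<in> I" using level_socle[OF lev s, of "f w" d] f1[OF w] ds by simp
  then have "w \<in> lead_set I" using f1[OF w] by (force simp: lead_set_def)
  then show False using w B1 by blast
qed

theorem theorem3p14:
  fixes I :: "'k::field_char_0 poly3 set" and s d :: nat
  assumes "homogeneous_ideal I"
    and "artinian I"
    and "socle_degree I s"
    and "d < s"
    and "betti (gin I) 1 (d + 2) = betti (gin I) 2 (d + 2)"
    and "betti (gin I) 1 (d + 2) > 0"
  shows "\<not> level I"
proof
  assume lev: "level I"
  obtain g where g: "det3 g \<noteq> 0" and gin: "gin I = initial_ideal (act g I)"
    and borel: "\<And>i m. i < 2 \<Longrightarrow> var_exp 2 + m \<in> lead_set (act g I) \<Longrightarrow> var_exp i + m \<in> lead_set (act g I)"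
    using generic_coordinates[OF assms(1,2)] by metis
  let ?I = "act g I"
  let ?M = "lead_set ?I"
  note I = homogeneous_ideal_act[OF assms(1) g]
  note M = lead_set_add[OF homogeneous_ideal_is_ideal[OF I]]
  define B0 where "B0 = {u. Suc (tdeg u) = d \<and> u \<notin> ?M \<and> var_exp 2 + u \<in> ?M}"
  define B1 where "B1 = {u. tdeg u = d \<and> u \<notin> ?M \<and> var_exp 2 + u \<in> ?M}"
  have fin0: "finite B0" by (rule finite_subset[OF _ finite_tdeg[of "d - 1"]]) (auto simp: B0_def)
  have fin1: "finite B1" by (rule finite_subset[OF _ finite_tdeg[of d]]) (auto simp: B1_def)
  have J: "gin I = mono_ideal ?M"
    using initial_ideal_eq[OF homogeneous_ideal_is_ideal[OF I]] by (simp add: gin mono_ideal_def)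
  have "2 * card B1 \<le> betti (gin I) 1 (d + 2)"
    unfolding J by (rule betti_1_ge[OF M borel fin1]) (simp_all add: B1_def)
  \<comment> \<open>A socle monomial u of R/Gin(I) satisfies in particular x_2 u \<in> Gin(I), so it
    belongs to \<open>B0\<close>.\<close>
  moreover have "betti (gin I) 2 (d + 2) \<le> card B0"
    unfolding J by (rule betti_2_le[OF M fin0]) (simp_all add: B0_def)
  \<comment> \<open>The two estimates meet at the common Betti number, and its positivity makes
    \<open>B0\<close> nonempty.\<close>
  ultimately have "2 * card B1 \<le> card B0" "B0 \<noteq> {}"
    using assms(5,6) by auto
  moreover have "socle_degree ?I s"
    using assms(3) by (simp add: socle_degree_def A_nonzero_in_act[OF g])
  ultimately have "\<not> level ?I"
    using not_level_if_kernel_drops[OF I _ assms(4) B0_def B1_def] by blast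
  then show False using level_act[OF assms(1) g lev] by blast
qed

end
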